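(* Let $\Bbbk$ be a field, let $\mathcal{A}$ be an essential arrangement of $n+1$ distinct hyperplanes in an $(r+1)$-dimensional $\Bbbk$-vector space $L$, with chosen defining linear forms $x_0,\ldots,x_n$ embedding $L$ in $\Bbbk^{n+1}$, let $M$ be the matroid of $\mathcal{A}$ on $\{0,\ldots,n\}$, with characteristic polynomial $\chi_M$, and let $\Gamma_{\mathcal{A}}\subseteq\mathbb{P}^n\times\mathbb{P}^n$ be the reciprocal graph, with defining ideal $I(\Gamma_{\mathcal{A}})$ in the bihomogeneous coordinate ring $S=\Bbbk[x_0,\ldots,x_n,y_0,\ldots,y_n]$ of $\mathbb{P}^n\times\mathbb{P}^n$. Then the bigraded Hilbert series of $S/I(\Gamma_{\mathcal{A}})$, with $x$-degree counted by $q$ and $y$-degree counted by $t$, is $$H(\Gamma_{\mathcal{A}};q,t)=\frac{1}{1-qt}\left(\frac{t}{t-1}\right)^{r+1}\chi_M\left(\frac{t-1}{(1-q)t}\right).$$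
   Context: **Arrangement.** $\Bbbk$ is a field and $\mathcal{A}$ is an arrangement of $n+1$ distinct (linear) hyperplanes in an $(r+1)$-dimensional $\Bbbk$-vector space $L$. It is assumed essential: the intersection of all the hyperplanes is $\{0\}$. For each $i\in\{0,\ldots,n\}$ fix a linear form $x_i$ on $L$ whose zero set is the $i$-th hyperplane. These forms give an injective linear map $L\to\Bbbk^{n+1}$, by which $L$ is identified with its image. Then $\widetilde{L}\subseteq L$ denotes the complement of the coordinate hyperplanes $x_i=0$, and $\mathbb{P}(\widetilde{L})\subseteq\mathbb{P}^n$ its projectivization. **Matroid and characteristic polynomial.** $M$ is the matroid of rank $r+1$ on $\{0,\ldots,n\}$ in which a set $\mathcal{C}$ is dependent if and only if the linear forms $\{x_i\mid i\in\mathcal{C}\}$ on $L$ are linearly dependent. Its characteristic polynomial is $$\chi_M(q)=\sum_{F}\mu(\hat0,F)\,q^{r+1-r(F)},$$ where the sum is over all flats $F$ of $M$, $\mu$ is the Möbius function of the lattice of flats, $\hat0$ is the minimal flat, and $r(F)$ is the rank of $F$. **Reciprocal graph.** The Cremona transformation $\mathbb{P}^n\dashrightarrow\mathbb{P}^n$ sends $(z_0:\cdots:z_n)$ to $(z_0^{-1}:\cdots:z_n^{-1})$. The reciprocal graph $\Gamma_{\mathcal{A}}$ is the closure in $\mathbb{P}^n\times\mathbb{P}^n$ of the graph of the Cremona transformation restricted to $\mathbb{P}(\widetilde{L})$. Here varieties are understood as schemes over $\Bbbk$ (so $\mathbb{P}(\widetilde{L})$ is a nonempty open subscheme of $\mathbb{P}(L)$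 even if $\Bbbk$ is finite). In $S$ the $x_i$ are the homogeneous coordinates on the first factor and the $y_i$ those on the second, and $I(\Gamma_{\mathcal{A}})\subseteq S$ is the ideal generated by all bihomogeneous polynomials vanishing on $\Gamma_{\mathcal{A}}$. **Hilbert series.** $S$ is bigraded with $\deg x_i=(1,0)$ and $\deg y_i=(0,1)$, and $H(\Gamma_{\mathcal{A}};q,t)=\sum_{a,b\ge0}\dim_{\Bbbk}\big(S/I(\Gamma_{\mathcal{A}})\big)_{(a,b)}\,q^at^b$. The asserted equality is of this power series with the expansion of the rational function on the right-hand side. *)

theory Defs
  imports
    "HOL-Algebra.Algebraic_Closure_Type"
    "HOL-Computational_Algebra.Computational_Algebra"
    "HOL-Library.Poly_Mapping"
    "HOL-Analysis.Analysis"
begin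

section \<open>Matroids on a finite ground set and their characteristic polynomials\<close>

text \<open>A matroid on the finite ground type \<open>'i\<close> is given by its set of independent sets.\<close>

definition matroid_rank :: "'i::finite set set \<Rightarrow> 'i set \<Rightarrow> nat" where
  "matroid_rank M A = Max {card C |C. C \<in> M \<and> C \<subseteq> A}"

definition flats :: "'i::finite set set \<Rightarrow> 'i set set" where
  "flats M = {F. \<forall>e. e \<notin> F \<longrightarrow> matroid_rank M (insert e F) > matroid_rank M F}"

text \<open>The Moebius function of a family of sets ordered by inclusion.\<close>

function moebius :: "'i::finite set set \<Rightarrow> 'i set \<Rightarrow> 'i set \<Rightarrow> int" where
  "moebius P A B =
     (if A = B then 1
      else if A \<subset> B then - (\<Sum>Z \<in> {Z \<in> P. A \<subseteq> Z \<and> Z \<subset> B}. moebius P A Z)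
      else 0)"
  by pat_completeness auto
termination
  by (relation "Wellfounded.measure (\<lambda>(P, A, B). card B)") (auto intro: psubset_card_mono)

declare moebius.simps [simp del]

definition min_flat :: "'i::finite set set \<Rightarrow> 'i set" where
  "min_flat M = \<Inter> (flats M)"

definition char_poly_matroid :: "'i::finite set set \<Rightarrow> int poly" where
  "char_poly_matroid M =
     (\<Sum>F \<in> flats M. Polynomial.monom (moebius (flats M) (min_flat M) F)
                       (matroid_rank M UNIV - matroid_rank M F))"

definition matroid_of_forms :: "('i::finite \<Rightarrow> 'v \<Rightarrow> 'k::field) \<Rightarrow> 'i set set" where
  "matroid_of_forms x =
     {C. \<forall>c. (\<forall>v. (\<Sum>i\<in>C. c i * x i v) = 0) \<longrightarrow> (\<forall>i\<in>C. c i = 0)}"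


section \<open>The bihomogeneous coordinate ring of a product of two projective spaces\<close>

text \<open>The variable \<open>Inl i\<close> is $x_i$ and \<open>Inr i\<close> is $y_i$.\<close>

type_synonym ('i, 'k) bipoly = "('i + 'i \<Rightarrow>\<^sub>0 nat) \<Rightarrow>\<^sub>0 'k"

definition bihomogeneous :: "nat \<Rightarrow> nat \<Rightarrow> ('i::finite, 'k::field) bipoly \<Rightarrow> bool" where
  "bihomogeneous a b f \<longleftrightarrow>
     (\<forall>m \<in> Poly_Mapping.keys f.
        (\<Sum>i\<in>UNIV. Poly_Mapping.lookup m (Inl i)) = a \<and>
        (\<Sum>i\<in>UNIV. Poly_Mapping.lookup m (Inr i)) = b)"

definition eval_bipoly ::
  "('i::finite, 'k::field) bipoly \<Rightarrow> 'k alg_closure ^ 'i \<Rightarrow> 'k alg_closure ^ 'i \<Rightarrow> 'k alg_closure"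
where
  "eval_bipoly f z w =
     (\<Sum>m \<in> Poly_Mapping.keys f. to_ac (Poly_Mapping.lookup f m)
        * (\<Prod>i\<in>UNIV. (z $ i) ^ Poly_Mapping.lookup m (Inl i))
        * (\<Prod>i\<in>UNIV. (w $ i) ^ Poly_Mapping.lookup m (Inr i)))"


section \<open>Projective varieties over \<open>'k\<close>\<close>

text \<open>
  A reduced closed subscheme of $\mathbb{P}^n \times \mathbb{P}^n$ over the field \<open>'k\<close> is
  represented by its set of points over the algebraic closure of \<open>'k\<close>. The Zariski topology is the
  one over \<open>'k\<close>: closed sets are cut out by bihomogeneous polynomials with coefficients in \<open>'k\<close>.
\<close>

type_synonym ('i, 'k) proj_point = "('k alg_closure ^ 'i) set"

definition proj_class :: "'k::field alg_closure ^ 'i::finite \<Rightarrow> ('i, 'k) proj_point" where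
  "proj_class z = {c *s z |c. c \<noteq> 0}"

definition proj_space :: "('i::finite, 'k::field) proj_point set" where
  "proj_space = proj_class ` {z. z \<noteq> 0}"

definition vanishes_at ::
  "('i::finite, 'k::field) bipoly \<Rightarrow> ('i, 'k) proj_point \<times> ('i, 'k) proj_point \<Rightarrow> bool" where
  "vanishes_at f p \<longleftrightarrow> (\<forall>z \<in> fst p. \<forall>w \<in> snd p. eval_bipoly f z w = 0)"

definition biproj_closed ::
  "(('i::finite, 'k::field) proj_point \<times> ('i, 'k) proj_point) set \<Rightarrow> bool" where
  "biproj_closed Z \<longleftrightarrow>
     (\<exists>F. (\<forall>f\<in>F. \<exists>a b. bihomogeneous a b f) \<and>
          Z = {p \<in> proj_space \<times> proj_space. \<forall>f\<in>F. vanishes_at f p})"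

text \<open>\<open>module.span (*)\<close> is the ideal generated by a set.\<close>

definition vanishing_ideal ::
  "(('i::finite, 'k::field) proj_point \<times> ('i, 'k) proj_point) set \<Rightarrow> ('i, 'k) bipoly set" where
  "vanishing_ideal Z =
     module.span (*) {f. (\<exists>a b. bihomogeneous a b f) \<and> (\<forall>p\<in>Z. vanishes_at f p)}"


section \<open>The reciprocal graph\<close>

text \<open>The points over the algebraic closure of the image of the space on which the forms live.\<close>

definition linear_space :: "('i::finite \<Rightarrow> 'v \<Rightarrow> 'k::field) \<Rightarrow> ('k alg_closure ^ 'i) set" where
  "linear_space x = vec.span (range (\<lambda>v. \<chi> i. to_ac (x i v)))"

definition linear_complement :: "('i::finite \<Rightarrow> 'v \<Rightarrow> 'k::field) \<Rightarrow> ('k alg_closure ^ 'i) set" where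
  "linear_complement x = {z \<in> linear_space x. \<forall>i. z $ i \<noteq> 0}"

definition reciprocal_graph ::
  "('i::finite \<Rightarrow> 'v \<Rightarrow> 'k::field) \<Rightarrow> (('i, 'k) proj_point \<times> ('i, 'k) proj_point) set" where
  "reciprocal_graph x =
     biproj_closed hull
       {(proj_class z, proj_class (\<chi> i. inverse (z $ i))) |z. z \<in> linear_complement x}"


section \<open>Bigraded Hilbert series\<close>

text \<open>
  The dimension of $W / (W \cap U)$ for subspaces $U$, $W$ with finite-dimensional quotient: the
  size of a set of elements of $W$ whose classes form a basis of the quotient.
\<close>

definition quotient_dim ::
  "('k::field \<Rightarrow> 'w::ab_group_add \<Rightarrow> 'w) \<Rightarrow> 'w set \<Rightarrow> 'w set \<Rightarrow> nat" where
  "quotient_dim sc W U =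
     (THE d. \<exists>B. B \<subseteq> W \<and> finite B \<and> card B = d \<and>
        (\<forall>c. (\<Sum>b\<in>B. sc (c b) b) \<in> U \<longrightarrow> (\<forall>b\<in>B. c b = 0)) \<and>
        (\<forall>w\<in>W. \<exists>c. w - (\<Sum>b\<in>B. sc (c b) b) \<in> U))"

text \<open>\<open>single 0 c\<close> is the constant polynomial \<open>c\<close>. The variable \<open>q\<close> is the outer one.\<close>

definition hilbert_series :: "('i::finite, 'k::field) bipoly set \<Rightarrow> int fps fps" where
  "hilbert_series I =
     Abs_fps (\<lambda>a. Abs_fps (\<lambda>b.
       int (quotient_dim (\<lambda>c f. Poly_Mapping.single 0 c * f) {f. bihomogeneous a b f} I)))"

text \<open>
  Rational functions in \<open>q\<close> and \<open>t\<close> are compared with power series in the field of fractions of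
  the power series ring; a rational function equals the image of a power series there iff the
  latter is its expansion.
\<close>

definition of_series :: "int fps fps \<Rightarrow> int fps fps fract" where
  "of_series f = Fract f 1"

definition var_q :: "int fps fps fract" where
  "var_q = of_series fps_X"

definition var_t :: "int fps fps fract" where
  "var_t = of_series (fps_const fps_X)"

end

theory Submission
  imports Defs "HOL-Library.Function_Algebras"
begin

no_notation fps_nth (infixl \<open>$\<close> 75)

text \<open>
  On a point $(z, z^{-1})$ of the graph the monomial $x^\alpha y^\beta$ takes the value
  $z^{\alpha - \beta}$. Hence the component of $S/I(\Gamma)$ in bidegree $(a,b)$ is the space of
  functions on \<open>linear_complement x\<close> spanned by the Laurent monomials $z^g$ whose exponent vectors $g$
  have coordinate sum $a - b$ and negative part of degree at most $b$, and its dimension is found by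
  exhibiting a basis consisting of Laurent monomials.

  Order the ground set and write $B$ for the set of indices where $g$ is negative. If some form $x_e$ is
  a combination of forms $x_b$ with $b \in B$ and $b > e$, multiplying $z^g$ by $1 = z_e^{-1} \sum c_b z_b$
  rewrites it by monomials with fewer poles or with poles moved to smaller indices. In the same way a
  factor $z_i$ with $i \notin B$ is replaced when $x_i$ depends on the $x_j$ with $j \in B$ or $j > i$.
  The monomials that admit no such rewriting are called \<^emph>\<open>standard\<close>: their pole set $B$ contains no
  broken circuit, and their zeros lie in a set $C_B$ which extends $B$ to a basis of the dual space.
  Rewriting terminates, so the standard monomials span (\<open>straightening\<close>). They are independent even over
  the algebraic closure (\<open>laurent_independent\<close>): clear the worst pole along the largest possible
  hyperplane, restrict to that hyperplane, and induct. Both conditions defining standard monomials are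
  inherited by the restriction.

  Multiplication by $qt$ corresponds to the inclusion of the monomials of bidegree $(a-1,b-1)$ in those of
  bidegree $(a,b)$, so $(1-qt) H$ counts the standard exponents whose positive part has degree exactly $a$
  and whose negative part has degree exactly $b$. For a fixed $B$ the negative part is any function that
  is positive exactly on $B$ and the positive part is any function supported on $C_B$, whence
  \[ (1 - qt) H = \sum_B \Big(\frac{t}{1-t}\Big)^{|B|} \Big(\frac{1}{1-q}\Big)^{r + 1 - |B|}, \]
  summed over the sets $B$ without broken circuits (\<open>hilbert_series_eq\<close>). By Whitney's theorem
  (\<open>char_poly_eq_sum_nbc\<close>) $\chi_M(s) = \sum_B (-1)^{|B|} s^{r + 1 - |B|}$ over the same sets, and
  substituting $s = (t-1)/((1-q)t)$ gives the formula.
\<close>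

section \<open>Finite families in a vector space\<close>

lemma exists_maximal_rank:
  fixes f :: "'b \<Rightarrow> nat"
  assumes "finite S" "S \<noteq> {}"
  obtains i where "i \<in> S" "\<forall>j\<in>S. f j \<le> f i"
proof -
  have "Max (f ` S) \<in> f ` S" using assms by (intro Max_in) auto
  then obtain i where "i \<in> S" "f i = Max (f ` S)" by auto
  then show ?thesis using assms that by simp
qed

context vector_space
begin

text \<open>
  Matroids are given by families of forms indexed by the ground set, whereas independence in vector
  spaces is a property of sets; the two agree once repetitions are excluded.
\<close>

lemma family_independent_iff:
  assumes "finite C"
  shows "(\<forall>c. (\<Sum>i\<in>C. scale (c i) (u i)) = 0 \<longrightarrow> (\<forall>i\<in>C. c i = 0)) \<longleftrightarrow>
           inj_on u C \<and> independent (u ` C)"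
    (is "?L \<longleftrightarrow> ?R")
proof
  assume L: ?L
  have inj: "inj_on u C"
  proof (rule inj_onI, rule ccontr)
    fix i j assume ij: "i \<in> C" "j \<in> C" "u i = u j" "i \<noteq> j"
    let ?c = "\<lambda>l. (if l = i then 1 else 0) - (if l = j then 1 else 0 :: 'a)"
    have "(\<Sum>l\<in>C. scale (?c l) (u l))
        = (\<Sum>l\<in>C. if l = i then u l else 0) - (\<Sum>l\<in>C. if l = j then u l else 0)"
      unfolding sum_subtractf[symmetric]
      by (intro sum.cong) (auto simp: scale_left_diff_distrib)
    then have "(\<Sum>l\<in>C. scale (?c l) (u l)) = 0" using ij assms by simp
    then have "?c i = 0" using L[THEN spec[of _ ?c]] ij(1) by blast
    then show False using ij(4) by simp
  qed
  have "independent (u ` C)"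
  proof (rule independent_if_scalars_zero)
    fix f w assume "(\<Sum>w\<in>u ` C. scale (f w) w) = 0" and w: "w \<in> u ` C"
    then have "(\<Sum>i\<in>C. scale (f (u i)) (u i)) = 0"
      by (simp add: sum.reindex[OF inj])
    then show "f w = 0" using L[THEN spec[of _ "\<lambda>i. f (u i)"]] w by blast
  qed (use assms in simp)
  then show ?R using inj by simp
next
  assume R: ?R
  show ?L
  proof (intro allI impI ballI)
    fix c i assume z: "(\<Sum>i\<in>C. scale (c i) (u i)) = 0" and i: "i \<in> C"
    let ?f = "\<lambda>w. c (inv_into C u w)"
    have "(\<Sum>w\<in>u ` C. scale (?f w) w) = (\<Sum>i\<in>C. scale (c i) (u i))"
      using R by (simp add: sum.reindex)
    then have "?f (u i) = 0"
      using z i R assms independentD[of "u ` C" "u ` C" ?f "u i"] by auto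
    then show "c i = 0" using R i by simp
  qed
qed

lemma span_family_relation:
  assumes "finite S" and "w \<in> span (u ` S)"
  obtains c where "w = (\<Sum>b\<in>S. scale (c b) (u b))"
proof -
  let ?R = "{w. \<exists>c. w = (\<Sum>b\<in>S. scale (c b) (u b))}"
  have "span (u ` S) \<subseteq> ?R"
  proof (rule span_minimal)
    show "u ` S \<subseteq> ?R"
    proof
      fix w assume "w \<in> u ` S"
      then obtain b where b: "b \<in> S" "w = u b" by blast
      have "(\<Sum>b'\<in>S. scale (if b' = b then 1 else 0) (u b')) = (\<Sum>b'\<in>S. if b' = b then u b' else 0)"
        by (intro sum.cong) auto
      then have "w = (\<Sum>b'\<in>S. scale (if b' = b then 1 else 0) (u b'))" using b assms(1) by simp
      then show "w \<in> ?R" by (intro CollectI exI[of _ "\<lambda>b'. if b' = b then 1 else 0"])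
    qed
    show "subspace ?R"
    proof (rule subspaceI)
      have "0 = (\<Sum>b\<in>S. scale 0 (u b))" by simp
      then show "0 \<in> ?R" by (intro CollectI exI[of _ "\<lambda>_. 0"])
    next
      fix v w assume "v \<in> ?R" "w \<in> ?R"
      then obtain c d where "v = (\<Sum>b\<in>S. scale (c b) (u b))" "w = (\<Sum>b\<in>S. scale (d b) (u b))" by blast
      then have "v + w = (\<Sum>b\<in>S. scale (c b + d b) (u b))"
        by (simp add: scale_left_distrib sum.distrib)
      then show "v + w \<in> ?R" by (intro CollectI exI[of _ "\<lambda>b. c b + d b"])
    next
      fix a v assume "v \<in> ?R"
      then obtain c where "v = (\<Sum>b\<in>S. scale (c b) (u b))" by blast
      then have "scale a v = (\<Sum>b\<in>S. scale (a * c b) (u b))"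
        by (simp add: scale_sum_right)
      then show "scale a v \<in> ?R" by (intro CollectI exI[of _ "\<lambda>b. a * c b"])
    qed
  qed
  then show ?thesis using assms(2) that by blast
qed

end

section \<open>Broken circuits and the characteristic polynomial\<close>

locale vector_family = vector_space sc
  for sc :: "'k::field \<Rightarrow> 'w::ab_group_add \<Rightarrow> 'w" +
  fixes u :: "'i::finite \<Rightarrow> 'w"
    and ord :: "'i \<Rightarrow> nat"
  assumes inj_ord: "inj ord"
begin

definition rk :: "'i set \<Rightarrow> nat" where
  "rk S = dim (u ` S)"

definition family_matroid :: "'i set set" where
  "family_matroid = {C. inj_on u C \<and> independent (u ` C)}"

text \<open>
  A set contains no broken circuit (a circuit without its least element) iff no vector of the family
  depends on the larger members of the set. Taking \<open>e\<close> inside the set, the condition also says that the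
  set is independent.
\<close>

definition nbc :: "'i set \<Rightarrow> bool" where
  "nbc B \<longleftrightarrow> (\<forall>e. u e \<notin> span (u ` {b \<in> B. ord b > ord e}))"

text \<open>
  The indices chosen when \<open>B\<close> is extended to a basis greedily, from the largest index downwards.
\<close>

definition compl_basis :: "'i set \<Rightarrow> 'i set" where
  "compl_basis B = {i. u i \<notin> span (u ` (B \<union> {j. ord j > ord i}))}"

lemma rk_empty [simp]: "rk {} = 0"
  unfolding rk_def using dim_le_card[of "{}" "{}"] by auto

lemma dim_insert_finite:
  assumes "finite S"
  shows "dim (insert a S) = (if a \<in> span S then dim S else Suc (dim S))"
proof (cases "a \<in> span S")
  case True
  then show ?thesis using span_redundant span_eq_dim by metis
next
  case False
  obtain B where B: "B \<subseteq> S" "independent B" "S \<subseteq> span B" "card B = dim S"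
    using basis_exists by blast
  have "finite B" using B(1) assms finite_subset by blast
  have "span B = span S"
    using B(1,3) by (metis span_eq span_mono order_trans span_superset)
  then have a: "a \<notin> span B" using False by simp
  then have "a \<notin> B" using span_base by blast
  have "dim (insert a S) = Suc (dim S)"
  proof (rule dim_unique)
    show "insert a B \<subseteq> insert a S" using B by blast
    show "insert a S \<subseteq> span (insert a B)"
      using B(3) by (meson insert_subset order_trans span_base span_mono insertI1 subset_insertI)
    show "independent (insert a B)" using a B(2) independent_insertI by blast
    show "card (insert a B) = Suc (dim S)" using B(4) \<open>finite B\<close> \<open>a \<notin> B\<close> by simp
  qed
  then show ?thesis using False by simp
qed

lemma rk_insert: "rk (insert e S) = (if u e \<in> span (u ` S) then rk S else Suc (rk S))"
  unfolding rk_def using dim_insert_finite[of "u ` S" "u e"] by simp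

text \<open>
  Independence of a family is most conveniently checked along an enumeration \<open>f\<close>: each member must avoid
  the span of the earlier ones.
\<close>

lemma rk_eq_card:
  fixes f :: "'i \<Rightarrow> nat"
  assumes "inj f" and "\<And>b. b \<in> S \<Longrightarrow> u b \<notin> span (u ` {b' \<in> S. f b' < f b})"
  shows "rk S = card S"
proof -
  have "finite S" by simp
  then show ?thesis using assms(2)
  proof (induction S rule: finite_ranking_induct[where f = f])
    case (insert a S)
    have lt: "f y < f a" if "y \<in> S" "a \<notin> S" for y
      using insert.hyps(2)[OF that(1)] that injD[OF \<open>inj f\<close>, of y a]
      by (metis le_neq_implies_less)
    show ?case
    proof (cases "a \<in> S")
      case True
      then have "insert a S = S" by blast
      then show ?thesis using insert.IH insert.prems by simp
    next
      case False
      note lt = lt[OF _ False]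
      have "{b' \<in> insert a S. f b' < f a} = S" using lt by auto
      then have "u a \<notin> span (u ` S)" using insert.prems[of a] by simp
      moreover have "rk S = card S"
      proof (rule insert.IH)
        fix b assume "b \<in> S"
        have "{b' \<in> insert a S. f b' < f b} = {b' \<in> S. f b' < f b}"
          using lt[OF \<open>b \<in> S\<close>] by auto
        then show "u b \<notin> span (u ` {b' \<in> S. f b' < f b})"
          using insert.prems[of b] \<open>b \<in> S\<close> by simp
      qed
      ultimately show ?thesis using False by (simp add: rk_insert)
    qed
  qed simp
qed

lemma matroid_rank_family_matroid: "matroid_rank family_matroid A = rk A"
  unfolding matroid_rank_def
proof (rule Max_eqI)
  have "{card C |C. C \<in> family_matroid \<and> C \<subseteq> A} \<subseteq> card ` Pow A" by auto
  then show "finite {card C |C. C \<in> family_matroid \<and> C \<subseteq> A}"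
    by (rule finite_subset) simp
next
  fix n assume "n \<in> {card C |C. C \<in> family_matroid \<and> C \<subseteq> A}"
  then obtain C where C: "inj_on u C" "independent (u ` C)" "C \<subseteq> A" "n = card C"
    by (auto simp: family_matroid_def)
  obtain B where B: "B \<subseteq> u ` A" "independent B" "u ` A \<subseteq> span B" "card B = dim (u ` A)"
    using basis_exists by blast
  have "finite B" using B(1) by (rule finite_subset) simp
  have "u ` C \<subseteq> span B" using C(3) B(3) by blast
  then have "card (u ` C) \<le> card B"
    using independent_span_bound \<open>finite B\<close> C(2) by blast
  then show "n \<le> rk A" using C B by (simp add: rk_def card_image)
next
  obtain B where B: "B \<subseteq> u ` A" "independent B" "u ` A \<subseteq> span B" "card B = dim (u ` A)"
    using basis_exists by blast
  obtain C where "C \<subseteq> A" "inj_on u C" "B = u ` C" using B(1) by (meson subset_image_inj)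
  then show "rk A \<in> {card C |C. C \<in> family_matroid \<and> C \<subseteq> A}"
    using B by (auto simp: family_matroid_def rk_def card_image intro!: exI[of _ C])
qed

lemma nbc_rk: assumes "nbc B" shows "rk B = card B"
proof -
  define N where "N = Max (range ord)"
  have N: "ord i \<le> N" for i unfolding N_def by simp
  have less_iff: "N - ord i < N - ord j \<longleftrightarrow> ord j < ord i" for i j
    using N[of i] N[of j] by linarith
  show ?thesis
  proof (rule rk_eq_card)
    have "i = j" if "N - ord i = N - ord j" for i j
    proof -
      have "ord i = ord j" using that N[of i] N[of j] by linarith
      then show ?thesis using inj_ord by (simp add: inj_eq)
    qed
    then show "inj (\<lambda>i. N - ord i)" by (rule injI)
    fix b assume "b \<in> B"
    show "u b \<notin> span (u ` {b' \<in> B. N - ord b' < N - ord b})"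
      using assms unfolding less_iff nbc_def by blast
  qed
qed

lemma compl_basis_disjoint: "B \<inter> compl_basis B = {}"
  unfolding compl_basis_def by (auto intro: span_base)

lemma span_compl_basis: "u i \<in> span (u ` (B \<union> compl_basis B))"
proof (induction i rule: measure_induct_rule[where f = "\<lambda>i. Max (range ord) - ord i"])
  case (less i)
  show ?case
  proof (cases "i \<in> compl_basis B")
    case True then show ?thesis by (intro span_base) auto
  next
    case False
    then have i: "u i \<in> span (u ` (B \<union> {j. ord j > ord i}))" by (simp add: compl_basis_def)
    have "u j \<in> span (u ` (B \<union> compl_basis B))" if "ord j > ord i" for j
    proof (rule less.IH)
      have "ord j \<le> Max (range ord)" by simp
      then show "Max (range ord) - ord j < Max (range ord) - ord i" using that by linarith
    qed
    then have "u ` (B \<union> {j. ord j > ord i}) \<subseteq> span (u ` (B \<union> compl_basis B))"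
      by (auto intro: span_base)
    then show ?thesis using i span_minimal subspace_span by blast
  qed
qed

text \<open>
  Enumerate \<open>B\<close> downwards and then the complementary indices downwards; by definition each member is
  independent of the earlier ones, and together they span.
\<close>

lemma card_compl_basis:
  assumes "nbc B"
  shows "card B + card (compl_basis B) = rk UNIV"
proof -
  define N where "N = Suc (Max (range ord))"
  have N: "ord i < N" for i unfolding N_def by (simp add: less_Suc_eq_le)
  \<comment> \<open>The indices of \<open>B\<close> receive values at most \<open>N\<close>, the others values above \<open>N\<close>.\<close>
  define f where "f i = (if i \<in> B then N - ord i else 2 * N - ord i)" for i
  have "span (u ` UNIV) = span (u ` (B \<union> compl_basis B))"
    using span_compl_basis by (intro equalityI span_minimal span_mono) auto
  then have "rk UNIV = rk (B \<union> compl_basis B)" unfolding rk_def by (rule span_eq_dim)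
  also have "\<dots> = card (B \<union> compl_basis B)"
  proof (rule rk_eq_card[of f])
    have "i = j" if "f i = f j" for i j
    proof -
      have "ord i = ord j" using that N[of i] N[of j] unfolding f_def by (auto split: if_splits)
      then show ?thesis using inj_ord by (simp add: inj_eq)
    qed
    then show "inj f" by (rule injI)
    fix b assume b: "b \<in> B \<union> compl_basis B"
    show "u b \<notin> span (u ` {b' \<in> B \<union> compl_basis B. f b' < f b})"
    proof (cases "b \<in> B")
      case True
      have "ord b' > ord b \<and> b' \<in> B" if "f b' < f b" for b'
        using that True N[of b'] N[of b] unfolding f_def by (auto split: if_splits)
      then have "span (u ` {b' \<in> B \<union> compl_basis B. f b' < f b}) \<subseteq> span (u ` {b' \<in> B. ord b' > ord b})"
        by (intro span_mono image_mono) auto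
      then show ?thesis using assms unfolding nbc_def by blast
    next
      case False
      then have "b \<in> compl_basis B" using b by simp
      have "ord b' > ord b \<or> b' \<in> B" if "f b' < f b" for b'
        using that False N[of b'] N[of b] unfolding f_def by (auto split: if_splits)
      then have "span (u ` {b' \<in> B \<union> compl_basis B. f b' < f b}) \<subseteq> span (u ` (B \<union> {j. ord j > ord b}))"
        by (intro span_mono image_mono) auto
      then show ?thesis using \<open>b \<in> compl_basis B\<close> unfolding compl_basis_def by blast
    qed
  qed
  finally show ?thesis using compl_basis_disjoint by (simp add: card_Un_disjoint)
qed

text \<open>
  Whitney's sign-reversing involution. If a set contains a broken circuit, let \<open>e\<close> be the largest index
  whose vector depends on the members of the set above \<open>e\<close>. Inserting or removing \<open>e\<close> changes neither
  the rank nor the members above any index that is at least \<open>e\<close>, so the new set leads to the same \<open>e\<close>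
  and the two contributions cancel.
\<close>

lemma alternating_rank_sum_eq_nbc_sum:
  fixes g :: "nat \<Rightarrow> int poly"
  shows "(\<Sum>S\<in>UNIV. (-1) ^ card S * g (rk S)) = (\<Sum>B\<in>{B. nbc B}. (-1) ^ card B * g (card B))"
proof -
  define bad where "bad S = {e. u e \<in> span (u ` {b \<in> S. ord b > ord e})}" for S
  define top where "top S = (SOME e. e \<in> bad S \<and> (\<forall>e'\<in>bad S. ord e' \<le> ord e))" for S
  define tog where "tog S = (if top S \<in> S then S - {top S} else insert (top S) S)" for S
  define f where "f S = (-1) ^ card S * g (rk S)" for S
  have nbc_bad: "nbc S \<longleftrightarrow> bad S = {}" for S unfolding nbc_def bad_def by auto
  have top: "top S \<in> bad S" "\<And>e. e \<in> bad S \<Longrightarrow> ord e \<le> ord (top S)" if "\<not> nbc S" for S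
  proof -
    have "bad S \<noteq> {}" using that nbc_bad by simp
    then obtain e where "e \<in> bad S \<and> (\<forall>e'\<in>bad S. ord e' \<le> ord e)"
      using exists_maximal_rank[OF finite, of "bad S" ord] by metis
    then have "top S \<in> bad S \<and> (\<forall>e'\<in>bad S. ord e' \<le> ord (top S))"
      unfolding top_def by (rule someI)
    then show "top S \<in> bad S" "\<And>e. e \<in> bad S \<Longrightarrow> ord e \<le> ord (top S)" by auto
  qed
  have above: "{b \<in> tog S. ord b > ord e} = {b \<in> S. ord b > ord e}"
    if "ord (top S) \<le> ord e" for S e
    using that unfolding tog_def by auto
  have bad_iff: "e \<in> bad (tog S) \<longleftrightarrow> e \<in> bad S" if "ord (top S) \<le> ord e" for S e
    unfolding bad_def mem_Collect_eq above[OF that] ..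
  have top_tog: "top (tog S) = top S" and not_nbc_tog: "\<not> nbc (tog S)" if S: "\<not> nbc S" for S
  proof -
    have t: "top S \<in> bad (tog S)" using top(1)[OF S] bad_iff by blast
    then show *: "\<not> nbc (tog S)" using nbc_bad by blast
    have "ord (top S) \<le> ord (top (tog S))" using top(2)[OF * t] .
    moreover have "ord (top (tog S)) \<le> ord (top S)"
      using top(2)[OF S] bad_iff[OF calculation] top(1)[OF *] by blast
    ultimately show "top (tog S) = top S" using inj_ord by (simp add: inj_eq)
  qed
  have tog_tog: "tog (tog S) = S" if S: "\<not> nbc S" for S
    unfolding tog_def[of "tog S"] top_tog[OF S] by (auto simp: tog_def)
  have f_tog: "f (tog S) = - f S" if S: "\<not> nbc S" for S
  proof -
    let ?R = "S - {top S}"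
    have "u (top S) \<in> span (u ` {b \<in> S. ord b > ord (top S)})"
      using top(1)[OF S] by (simp add: bad_def)
    also have "\<dots> \<subseteq> span (u ` ?R)" by (intro span_mono image_mono) auto
    finally have dep: "u (top S) \<in> span (u ` ?R)" .
    have f_insert: "f (insert e R) = - f R" if "e \<notin> R" "u e \<in> span (u ` R)" for e R
      using that by (simp add: f_def rk_insert)
    show ?thesis
    proof (cases "top S \<in> S")
      case True
      then have "S = insert (top S) ?R" by blast
      then have "f S = - f ?R" using f_insert[OF _ dep] by simp
      then show ?thesis using True by (simp add: tog_def)
    next
      case False
      then show ?thesis using f_insert[OF _ dep] by (simp add: tog_def)
    qed
  qed
  have "(\<Sum>S\<in>{S. \<not> nbc S}. f S) = (\<Sum>S\<in>{S. \<not> nbc S}. f (tog S))"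
    by (rule sum.reindex_bij_witness[of _ tog tog]) (auto simp: tog_tog not_nbc_tog)
  also have "\<dots> = - (\<Sum>S\<in>{S. \<not> nbc S}. f S)"
    by (simp add: f_tog sum_negf)
  finally have cancel: "(\<Sum>S\<in>{S. \<not> nbc S}. f S) = 0" by simp
  have "(\<Sum>S\<in>UNIV. f S) = (\<Sum>S\<in>{S. nbc S}. f S) + (\<Sum>S\<in>{S. \<not> nbc S}. f S)"
    by (subst sum.union_disjoint[symmetric]) (auto intro: arg_cong[where f = "sum f"])
  also have "\<dots> = (\<Sum>B\<in>{B. nbc B}. (-1) ^ card B * g (card B))"
    unfolding cancel by (simp add: f_def nbc_rk)
  finally show ?thesis unfolding f_def .
qed

lemma flats_family_matroid:
  "flats family_matroid = {F. \<forall>e. u e \<in> span (u ` F) \<longrightarrow> e \<in> F}"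
  unfolding flats_def matroid_rank_family_matroid by (auto simp: rk_insert split: if_splits)

lemma alternating_sum_Pow:
  assumes "finite F" shows "(\<Sum>S\<in>Pow F. (-1) ^ card S) = (if F = {} then 1 else 0 :: int)"
proof -
  have "(\<Sum>S\<in>Pow F. (-1) ^ card S) = (\<Sum>S\<in>Pow F. (\<Prod>x\<in>S. -1) * (\<Prod>x\<in>F - S. 1 :: int))"
    by simp
  also have "\<dots> = (\<Prod>x\<in>F. -1 + 1 :: int)"
    using prod_add[OF assms, of "\<lambda>_. -1 :: int" "\<lambda>_. 1"] by simp
  also have "\<dots> = (if F = {} then 1 else 0)"
    using assms by (auto simp: card_gt_0_iff power_0_left)
  finally show ?thesis .
qed

definition cl :: "'i set \<Rightarrow> 'i set" where
  "cl S = {e. u e \<in> span (u ` S)}"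

lemma span_image_cl: "span (u ` cl S) = span (u ` S)"
  by (intro equalityI span_minimal span_mono) (auto simp: cl_def intro: span_base)

lemma cl_flat: "cl S \<in> flats family_matroid"
  unfolding flats_family_matroid mem_Collect_eq span_image_cl by (simp add: cl_def)

lemma cl_subset_flat_iff: "F \<in> flats family_matroid \<Longrightarrow> cl S \<subseteq> F \<longleftrightarrow> S \<subseteq> F"
proof
  assume "cl S \<subseteq> F" then show "S \<subseteq> F" by (auto simp: cl_def intro: span_base)
next
  assume F: "F \<in> flats family_matroid" and "S \<subseteq> F"
  then have "span (u ` S) \<subseteq> span (u ` F)" by (intro span_mono image_mono)
  then show "cl S \<subseteq> F" using F by (auto simp: cl_def flats_family_matroid)
qed

context
  assumes nonzero: "\<And>e. u e \<noteq> 0"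
begin

lemma empty_flat: "{} \<in> flats family_matroid"
  using nonzero by (simp add: flats_family_matroid)

lemma min_flat_eq: "min_flat family_matroid = {}"
  unfolding min_flat_def using empty_flat by blast

text \<open>
  Both sides satisfy the recursion that determines the Moebius function: a set has its closure inside a
  flat \<open>F\<close> iff it is a subset of \<open>F\<close>, so summing the right-hand side over the flats below \<open>F\<close> gives the
  alternating sum over all subsets of \<open>F\<close>.
\<close>

lemma moebius_eq:
  assumes "F \<in> flats family_matroid"
  shows "moebius (flats family_matroid) {} F = (\<Sum>S | cl S = F. (-1) ^ card S)"
  using assms
proof (induction "card F" arbitrary: F rule: less_induct)
  case less
  let ?P = "flats family_matroid"
  let ?nu = "\<lambda>Z. \<Sum>S | cl S = Z. (-1) ^ card S :: int"
  have "(\<Sum>Z\<in>{Z \<in> ?P. Z \<subseteq> F}. ?nu Z) = (\<Sum>S\<in>Pow F. (-1) ^ card S)"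
  proof -
    have "(\<Sum>Z\<in>{Z \<in> ?P. Z \<subseteq> F}. ?nu Z)
        = (\<Sum>Z\<in>{Z \<in> ?P. Z \<subseteq> F}. \<Sum>S | S \<in> Pow F \<and> cl S = Z. (-1) ^ card S)"
      using cl_subset_flat_iff[OF less.prems] by (intro sum.cong) auto
    also have "\<dots> = (\<Sum>S\<in>Pow F. (-1) ^ card S)"
      using cl_subset_flat_iff[OF less.prems] cl_flat by (intro sum.group) auto
    finally show ?thesis .
  qed
  also have "\<dots> = (if F = {} then 1 else 0)" by (rule alternating_sum_Pow) simp
  also have "{Z \<in> ?P. Z \<subseteq> F} = insert F {Z \<in> ?P. {} \<subseteq> Z \<and> Z \<subset> F}" using less.prems by auto
  finally have "?nu F + (\<Sum>Z\<in>{Z \<in> ?P. {} \<subseteq> Z \<and> Z \<subset> F}. ?nu Z) = (if F = {} then 1 else 0)"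
    by simp
  moreover have "(\<Sum>Z\<in>{Z \<in> ?P. {} \<subseteq> Z \<and> Z \<subset> F}. ?nu Z)
      = (\<Sum>Z\<in>{Z \<in> ?P. {} \<subseteq> Z \<and> Z \<subset> F}. moebius ?P {} Z)"
    by (intro sum.cong refl less.hyps[symmetric]) (auto intro: psubset_card_mono)
  ultimately have sum_nu: "?nu F + (\<Sum>Z\<in>{Z \<in> ?P. {} \<subseteq> Z \<and> Z \<subset> F}. moebius ?P {} Z)
      = (if F = {} then 1 else 0)" by simp
  show ?case
  proof (cases "F = {}")
    case True
    then show ?thesis using sum_nu by (subst moebius.simps) simp
  next
    case False
    then have "moebius ?P {} F = - (\<Sum>Z\<in>{Z \<in> ?P. {} \<subseteq> Z \<and> Z \<subset> F}. moebius ?P {} Z)"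
      by (subst moebius.simps) auto
    then show ?thesis using sum_nu False by simp
  qed
qed

text \<open>
  Whitney's broken circuit theorem: grouping the subsets of the ground set by their closures turns the
  Moebius sum over flats into an alternating sum over subsets that depends on their ranks only.
\<close>

lemma char_poly_eq_sum_nbc:
  "char_poly_matroid family_matroid =
     (\<Sum>B\<in>{B. nbc B}. Polynomial.monom ((-1) ^ card B) (rk UNIV - card B))"
proof -
  let ?P = "flats family_matroid"
  let ?g = "\<lambda>k. Polynomial.monom (1 :: int) (rk UNIV - k)"
  have rk_cl: "rk (cl S) = rk S" for S
    unfolding rk_def by (rule span_eq_dim) (rule span_image_cl)
  have "char_poly_matroid family_matroid
      = (\<Sum>F\<in>?P. \<Sum>S | S \<in> UNIV \<and> cl S = F. (-1) ^ card S * ?g (rk S))"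
    unfolding char_poly_matroid_def min_flat_eq matroid_rank_family_matroid
  proof (rule sum.cong)
    fix F assume F: "F \<in> ?P"
    have "Polynomial.monom (moebius ?P {} F) (rk UNIV - rk F) = of_int (moebius ?P {} F) * ?g (rk F)"
      by (simp add: of_int_poly smult_monom)
    also have "\<dots> = (\<Sum>S | S \<in> UNIV \<and> cl S = F. (-1) ^ card S * ?g (rk F))"
      by (simp add: moebius_eq[OF F] sum_distrib_right)
    also have "\<dots> = (\<Sum>S | S \<in> UNIV \<and> cl S = F. (-1) ^ card S * ?g (rk S))"
      by (intro sum.cong) (auto simp: rk_cl)
    finally show "Polynomial.monom (moebius ?P {} F) (rk UNIV - rk F)
        = (\<Sum>S | S \<in> UNIV \<and> cl S = F. (-1) ^ card S * ?g (rk S))" .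
  qed simp
  also have "\<dots> = (\<Sum>S\<in>UNIV. (-1) ^ card S * ?g (rk S))"
    using cl_flat by (intro sum.group) auto
  also have "\<dots> = (\<Sum>B\<in>{B. nbc B}. (-1) ^ card B * ?g (card B))"
    by (rule alternating_rank_sum_eq_nbc_sum)
  also have "\<dots> = (\<Sum>B\<in>{B. nbc B}. Polynomial.monom ((-1) ^ card B) (rk UNIV - card B))"
    by (intro sum.cong refl) (simp add: uminus_power_if minus_monom)
  finally show ?thesis .
qed

end

end

section \<open>Linear independence of Laurent monomials\<close>

definition laurent :: "('i::finite \<Rightarrow> int) \<Rightarrow> 'a::field ^ 'i \<Rightarrow> 'a" where
  "laurent g z = (\<Prod>i\<in>UNIV. (z $ i) powi g i)"

text \<open>
  Zariski density, needed only along lines: on the line \<open>z + t v\<close> with \<open>v $ i \<noteq> 0\<close>, clearing all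
  denominators gives a polynomial in \<open>t\<close> with infinitely many zeros, which therefore vanishes at \<open>t = 0\<close>
  as well. Dividing by the power \<open>m\<close> of the coordinate \<open>i\<close> keeps the relation meaningful at points \<open>z\<close>
  where this coordinate is zero.
\<close>

lemma laurent_relation_extends:
  fixes L :: "('a::field ^ 'i::finite) set" and c :: "('i \<Rightarrow> int) \<Rightarrow> 'a"
  assumes inf: "infinite (UNIV :: 'a set)" and L: "vec.subspace L" and T: "finite T"
    and v: "v \<in> L" "v $ i \<noteq> 0" and i: "i \<notin> E"
    and nonneg: "\<And>g j. g \<in> T \<Longrightarrow> j \<notin> insert i E \<Longrightarrow> 0 \<le> g j"
    and m: "\<And>g. g \<in> T \<Longrightarrow> m \<le> g i"
    and zero: "\<And>z. z \<in> L \<Longrightarrow> (\<And>j. j \<in> insert i E \<Longrightarrow> z $ j \<noteq> 0) \<Longrightarrow>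
                 (\<Sum>g\<in>T. c g * laurent g z) = 0"
    and z: "z \<in> L" "\<And>j. j \<in> E \<Longrightarrow> z $ j \<noteq> 0"
  shows "(\<Sum>g\<in>T. c g * laurent (g(i := g i - m)) z) = 0"
proof -
  define N where "N = nat (\<Sum>g\<in>T. \<Sum>j\<in>UNIV. \<bar>g j\<bar>)"
  have N: "- g j \<le> int N" if "g \<in> T" for g j
  proof -
    have "\<bar>g j\<bar> \<le> (\<Sum>j\<in>UNIV. \<bar>g j\<bar>)" by (rule member_le_sum) auto
    also have "\<dots> \<le> (\<Sum>g\<in>T. \<Sum>j\<in>UNIV. \<bar>g j\<bar>)"
      using T that by (intro member_le_sum[where f = "\<lambda>g. \<Sum>j\<in>UNIV. \<bar>g j\<bar>"]) (auto intro: sum_nonneg)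
    finally have "- g j \<le> (\<Sum>g\<in>T. \<Sum>j\<in>UNIV. \<bar>g j\<bar>)" by linarith
    then show ?thesis unfolding N_def by linarith
  qed
  \<comment> \<open>The exponents after clearing denominators: all of them are nonnegative.\<close>
  define ex where "ex g j = nat (if j = i then g i - m else if j \<in> E then g j + int N else g j)"
    for g :: "'i \<Rightarrow> int" and j
  define q where "q w = (\<Prod>j\<in>E. w $ j ^ N)" for w :: "'a ^ 'i"
  have clear: "(\<Prod>j\<in>UNIV. w $ j ^ ex g j) = q w * laurent (g(i := g i - m)) w"
    if g: "g \<in> T" and w: "\<And>j. j \<in> E \<Longrightarrow> w $ j \<noteq> 0" for g and w :: "'a ^ 'i"
  proof -
    have "q w = (\<Prod>j\<in>UNIV. if j \<in> E then w $ j ^ N else 1)"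
      unfolding q_def by (simp add: prod.If_cases)
    then have "q w * laurent (g(i := g i - m)) w =
        (\<Prod>j\<in>UNIV. (if j \<in> E then w $ j ^ N else 1) * w $ j powi (g(i := g i - m)) j)"
      by (simp add: laurent_def prod.distrib)
    also have "\<dots> = (\<Prod>j\<in>UNIV. w $ j ^ ex g j)"
    proof (rule prod.cong)
      fix j
      consider "j = i" | "j \<noteq> i" "j \<in> E" | "j \<noteq> i" "j \<notin> E" by blast
      then show "(if j \<in> E then w $ j ^ N else 1) * w $ j powi (g(i := g i - m)) j = w $ j ^ ex g j"
      proof cases
        case 1
        then show ?thesis using m[OF g] i by (simp add: ex_def power_int_def)
      next
        case 2
        have "w $ j ^ N * w $ j powi g j = w $ j powi (int N + g j)"
          using w[OF 2(2)] by (simp add: power_int_add)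
        also have "\<dots> = w $ j ^ ex g j"
          using 2 N[OF g, of j] by (simp add: ex_def power_int_def add.commute)
        finally show ?thesis using 2 by simp
      next
        case 3
        then show ?thesis using nonneg[OF g, of j] by (simp add: ex_def power_int_def)
      qed
    qed simp
    finally show ?thesis by simp
  qed
  \<comment> \<open>The coordinate \<open>j\<close> on the line, as a polynomial in the parameter.\<close>
  define lin where "lin j = [:z $ j, v $ j:]" for j
  define G where "G = (\<Sum>g\<in>T. smult (c g) (\<Prod>j\<in>UNIV. lin j ^ ex g j))"
  have poly_lin: "poly (lin j) t = (z + t *s v) $ j" for j t
    by (simp add: lin_def)
  have poly_G: "poly G t = (\<Sum>g\<in>T. c g * (\<Prod>j\<in>UNIV. (z + t *s v) $ j ^ ex g j))" for t
    unfolding G_def by (simp add: poly_sum poly_prod poly_power poly_lin del: vector_add_component)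
  \<comment> \<open>The extra factors make the product vanish also where the line meets a hyperplane.\<close>
  have "poly (G * (lin i * (\<Prod>j\<in>E. lin j))) t = 0" for t
  proof (cases "\<forall>j\<in>insert i E. (z + t *s v) $ j \<noteq> 0")
    case True
    let ?w = "z + t *s v"
    have "?w \<in> L" using L z(1) v(1) by (simp add: vec.subspace_add vec.subspace_scale)
    have w: "laurent (g(i := g i - m)) ?w = ?w $ i powi (- m) * laurent g ?w" for g
    proof -
      have "laurent (g(i := g i - m)) ?w
          = (\<Prod>j\<in>UNIV. (if j = i then ?w $ j powi (- m) else 1) * ?w $ j powi g j)"
        unfolding laurent_def using True
        by (intro prod.cong) (auto simp: power_int_add[symmetric] simp del: vector_add_component)
      then show ?thesis by (simp add: prod.distrib laurent_def del: vector_add_component)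
    qed
    have "poly G t = (\<Sum>g\<in>T. (q ?w * ?w $ i powi (- m)) * (c g * laurent g ?w))"
      unfolding poly_G using True by (intro sum.cong refl) (subst clear, auto simp: w mult_ac)
    also have "\<dots> = 0"
      using zero[OF \<open>?w \<in> L\<close>] True by (simp flip: sum_distrib_left del: vector_add_component)
    finally show ?thesis by simp
  next
    case False
    then show ?thesis by (auto simp: poly_prod poly_lin simp del: vector_add_component)
  qed
  then have "G * (lin i * (\<Prod>j\<in>E. lin j)) = 0"
    using inf poly_roots_finite by (metis (full_types) UNIV_eq_I mem_Collect_eq)
  moreover have "lin i \<noteq> 0" "(\<Prod>j\<in>E. lin j) \<noteq> 0" using v z(2) by (auto simp: lin_def)
  ultimately have "G = 0" by simp
  then have "0 = poly G 0" by simp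
  also have "\<dots> = (\<Sum>g\<in>T. q z * (c g * laurent (g(i := g i - m)) z))"
    unfolding poly_G using z(2) by (intro sum.cong refl) (simp add: clear mult_ac)
  also have "\<dots> = q z * (\<Sum>g\<in>T. c g * laurent (g(i := g i - m)) z)"
    by (simp flip: sum_distrib_left)
  finally show ?thesis using z(2) by (simp add: q_def)
qed

text \<open>
  Restricting to the hyperplane where the coordinate \<open>i\<close> is zero kills every monomial except those with
  the least exponent \<open>m\<close> at \<open>i\<close>, so these satisfy a relation with the same coefficients on the
  hyperplane section.
\<close>

lemma laurent_relation_leading_part:
  fixes L :: "('a::field ^ 'i::finite) set" and c :: "('i \<Rightarrow> int) \<Rightarrow> 'a"
  assumes inf: "infinite (UNIV :: 'a set)" and L: "vec.subspace L" and T: "finite T"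
    and v: "v \<in> L" "v $ i \<noteq> 0" and i: "i \<notin> E"
    and nonneg: "\<And>g j. g \<in> T \<Longrightarrow> j \<notin> insert i E \<Longrightarrow> 0 \<le> g j"
    and m: "\<And>g. g \<in> T \<Longrightarrow> m \<le> g i"
    and zero: "\<And>z. z \<in> L \<Longrightarrow> (\<And>j. j \<in> insert i E \<Longrightarrow> z $ j \<noteq> 0) \<Longrightarrow>
                 (\<Sum>g\<in>T. c g * laurent g z) = 0"
    and z: "z \<in> L" "z $ i = 0" "\<And>j. j \<in> E \<Longrightarrow> z $ j \<noteq> 0"
  shows "(\<Sum>g\<in>(\<lambda>g. g(i := 0)) ` {g \<in> T. g i = m}. c (g(i := m)) * laurent g z) = 0"
proof -
  have inj: "inj_on (\<lambda>g. g(i := 0)) {g \<in> T. g i = m}"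
  proof (rule inj_onI)
    fix g h assume "g \<in> {g \<in> T. g i = m}" "h \<in> {g \<in> T. g i = m}" "g(i := 0) = h(i := 0)"
    then show "g = h" by (metis (mono_tags, lifting) fun_upd_triv fun_upd_upd mem_Collect_eq)
  qed
  have vanish: "laurent (g(i := g i - m)) z = 0" if "g \<in> T" "g i \<noteq> m" for g
    using m[OF that(1)] that(2) z(2) unfolding laurent_def
    by (auto intro!: bexI[of _ i])
  have "0 = (\<Sum>g\<in>T. c g * laurent (g(i := g i - m)) z)"
    by (rule laurent_relation_extends[where L = L and v = v and E = E, symmetric])
      (use assms in auto)
  also have "\<dots> = (\<Sum>g\<in>{g \<in> T. g i = m}. c g * laurent (g(i := g i - m)) z)"
    using T vanish by (intro sum.mono_neutral_right) auto
  also have "\<dots> = (\<Sum>g\<in>{g \<in> T. g i = m}. c (g(i := 0, i := m)) * laurent (g(i := 0)) z)"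
    by (intro sum.cong) auto
  finally show ?thesis by (simp add: sum.reindex[OF inj])
qed

lemma subspace_coordinate_zero:
  "vec.subspace L \<Longrightarrow> vec.subspace {z \<in> L. z $ i = 0}"
  by (auto simp: vec.subspace_def)

text \<open>
  The case without poles. The condition on \<open>L\<close> says that the indices that may occur index coordinates in
  echelon position. Restricting to the hyperplane of the largest index that occurs keeps the remaining
  coordinates in echelon position and lowers the number of indices in use.
\<close>

lemma monomials_independent:
  fixes L :: "('a::field ^ 'i::finite) set" and c :: "('i \<Rightarrow> int) \<Rightarrow> 'a" and ord :: "'i \<Rightarrow> nat"
  assumes inf: "infinite (UNIV :: 'a set)" and "inj ord"
    and "vec.subspace L" and "finite T"
    and "\<And>g j. g \<in> T \<Longrightarrow> 0 \<le> g j"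
    and "\<And>g i. g \<in> T \<Longrightarrow> 0 < g i \<Longrightarrow> \<exists>z\<in>L. z $ i \<noteq> 0 \<and> (\<forall>j. ord i < ord j \<longrightarrow> z $ j = 0)"
    and "\<And>z. z \<in> L \<Longrightarrow> (\<Sum>g\<in>T. c g * laurent g z) = 0"
    and "\<And>g. g \<in> T \<Longrightarrow> c g \<noteq> 0"
  shows "T = {}"
  using assms(3-)
proof (induction "card {i. \<exists>g\<in>T. g i \<noteq> 0}" arbitrary: L T c rule: less_induct)
  case less
  note L = less.prems(1) and T = less.prems(2) and nonneg = less.prems(3) and wit = less.prems(4)
    and zero = less.prems(5) and nz = less.prems(6)
  let ?S = "{i. \<exists>g\<in>T. g i \<noteq> 0}"
  show ?case
  proof (rule ccontr)
    assume "T \<noteq> {}"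
    show False
    proof (cases "?S = {}")
      case True
      then have "g = (\<lambda>_. 0)" if "g \<in> T" for g using that by auto
      then have "T = {\<lambda>_. 0}" using \<open>T \<noteq> {}\<close> by blast
      then show False
        using zero[of 0] nz[of "\<lambda>_. 0"] L by (simp add: laurent_def vec.subspace_0)
    next
      case False
      obtain i where i: "i \<in> ?S" "\<forall>j\<in>?S. ord j \<le> ord i"
        using exists_maximal_rank[OF finite False, of ord] .
      then obtain h where "h \<in> T" "0 < h i" using nonneg by (auto simp: order_less_le)
      then obtain v where v: "v \<in> L" "v $ i \<noteq> 0" using wit by blast
      define m where "m = Min ((\<lambda>g. g i) ` T)"
      have m: "m \<le> g i" if "g \<in> T" for g using that T by (simp add: m_def)
      have "m \<in> (\<lambda>g. g i) ` T" unfolding m_def using T \<open>T \<noteq> {}\<close> by (intro Min_in) auto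
      then obtain g0 where g0: "g0 \<in> T" "g0 i = m" by auto
      let ?T = "(\<lambda>g. g(i := 0)) ` {g \<in> T. g i = m}"
      let ?L = "{z \<in> L. z $ i = 0}"
      have "?T = {}"
      proof (rule less.hyps[where L = ?L and c = "\<lambda>g. c (g(i := m))"])
        have "{j. \<exists>g\<in>?T. g j \<noteq> 0} \<subseteq> ?S - {i}" by (auto split: if_splits)
        then have "{j. \<exists>g\<in>?T. g j \<noteq> 0} \<subset> ?S" using i(1) by blast
        then show "card {j. \<exists>g\<in>?T. g j \<noteq> 0} < card ?S" by (intro psubset_card_mono) auto
        show "vec.subspace ?L" using L by (rule subspace_coordinate_zero)
        show "finite ?T" using T by simp
        show "0 \<le> g j" if "g \<in> ?T" for g j using that nonneg by auto
        show "\<exists>z\<in>?L. z $ k \<noteq> 0 \<and> (\<forall>j. ord k < ord j \<longrightarrow> z $ j = 0)"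
          if g: "g \<in> ?T" and k: "0 < g k" for g k
        proof -
          obtain h where h: "h \<in> T" "g = h(i := 0)" using g by auto
          then have "k \<noteq> i" "0 < h k" using k by (auto split: if_splits)
          then have "ord k < ord i"
            using bspec[OF i(2), of k] h(1) injD[OF \<open>inj ord\<close>, of k i] by force
          then show ?thesis using wit[OF h(1) \<open>0 < h k\<close>] by blast
        qed
        show "(\<Sum>g\<in>?T. c (g(i := m)) * laurent g z) = 0" if "z \<in> ?L" for z
          by (rule laurent_relation_leading_part[where E = "{}" and L = L and v = v])
            (use inf L T v nonneg m zero that in auto)
        show "c (g(i := m)) \<noteq> 0" if g: "g \<in> ?T" for g
        proof -
          obtain h where "h \<in> T" "h i = m" "g = h(i := 0)" using g by blast
          then show ?thesis using nz[of h] by (metis fun_upd_triv fun_upd_upd)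
        qed
      qed
      then show False using g0 by blast
    qed
  qed
qed

text \<open>
  Induction on the set \<open>E\<close> of possible poles, through its largest element \<open>i\<close>. If a pole occurs at \<open>i\<close>,
  restrict the part with the worst pole to the hyperplane of \<open>i\<close>: as \<open>i\<close> is above every other element of
  \<open>E\<close> and is itself a pole, the witnesses required for the remaining indices already lie on this
  hyperplane. If no pole occurs at \<open>i\<close>, the relation extends across its hyperplane.
\<close>

lemma laurent_independent_poles_within:
  fixes L :: "('a::field ^ 'i::finite) set" and c :: "('i \<Rightarrow> int) \<Rightarrow> 'a" and ord :: "'i \<Rightarrow> nat"
  assumes inf: "infinite (UNIV :: 'a set)" and "inj ord"
    and "vec.subspace L" and "finite T"
    and "\<And>g j. g \<in> T \<Longrightarrow> g j < 0 \<Longrightarrow> j \<in> E"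
    and "\<And>g e. g \<in> T \<Longrightarrow> e \<in> E \<Longrightarrow>
           \<exists>z\<in>L. z $ e \<noteq> 0 \<and> (\<forall>b. g b < 0 \<and> ord e < ord b \<longrightarrow> z $ b = 0)"
    and "\<And>g i. g \<in> T \<Longrightarrow> 0 < g i \<Longrightarrow>
           \<exists>z\<in>L. z $ i \<noteq> 0 \<and> (\<forall>j. g j < 0 \<or> ord i < ord j \<longrightarrow> z $ j = 0)"
    and "\<And>z. z \<in> L \<Longrightarrow> (\<And>j. j \<in> E \<Longrightarrow> z $ j \<noteq> 0) \<Longrightarrow> (\<Sum>g\<in>T. c g * laurent g z) = 0"
    and "\<And>g. g \<in> T \<Longrightarrow> c g \<noteq> 0"
  shows "T = {}"
  using assms(3-)
proof (induction "card E" arbitrary: E L T c)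
  case 0
  then have "E = {}" by simp
  note p = "0.prems"
  show ?case
  proof (rule monomials_independent[OF inf \<open>inj ord\<close> p(1,2)])
    show "0 \<le> g j" if "g \<in> T" for g j using p(3)[OF that, of j] \<open>E = {}\<close> by force
    show "\<exists>z\<in>L. z $ i \<noteq> 0 \<and> (\<forall>j. ord i < ord j \<longrightarrow> z $ j = 0)" if "g \<in> T" "0 < g i" for g i
      using p(5)[OF that] by blast
    show "(\<Sum>g\<in>T. c g * laurent g z) = 0" if "z \<in> L" for z using p(6)[OF that] \<open>E = {}\<close> by simp
    show "c g \<noteq> 0" if "g \<in> T" for g using p(7)[OF that] .
  qed
next
  case (Suc n)
  note L = Suc.prems(1) and T = Suc.prems(2) and neg = Suc.prems(3) and witE = Suc.prems(4)
    and witC = Suc.prems(5) and zero = Suc.prems(6) and nz = Suc.prems(7)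
  have "E \<noteq> {}" using Suc.hyps(2) by auto
  obtain i where i: "i \<in> E" "\<forall>j\<in>E. ord j \<le> ord i"
    using exists_maximal_rank[OF finite \<open>E \<noteq> {}\<close>, of ord] .
  have lt: "ord j < ord i" if "j \<in> E - {i}" for j
    using bspec[OF i(2), of j] that injD[OF \<open>inj ord\<close>, of j i] by force
  let ?E = "E - {i}"
  have ins: "insert i ?E = E" using i(1) by blast
  have card_E: "n = card ?E" using Suc.hyps(2) i(1) by simp
  show ?case
  proof (rule ccontr)
    assume "T \<noteq> {}"
    then obtain v where v: "v \<in> L" "v $ i \<noteq> 0" using witE i(1) by blast
    have nonneg: "0 \<le> g j" if "g \<in> T" "j \<notin> insert i ?E" for g j
      using neg[OF that(1), of j] that(2) ins by force
    have zero': "(\<Sum>g\<in>T. c g * laurent g z) = 0"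
      if "z \<in> L" "\<And>j. j \<in> insert i ?E \<Longrightarrow> z $ j \<noteq> 0" for z
      using zero that ins by blast
    show False
    proof (cases "\<exists>g\<in>T. g i < 0")
      case True
      define m where "m = Min ((\<lambda>g. g i) ` T)"
      have m: "m \<le> g i" if "g \<in> T" for g using that T by (simp add: m_def)
      have "m \<in> (\<lambda>g. g i) ` T" unfolding m_def using T \<open>T \<noteq> {}\<close> by (intro Min_in) auto
      then obtain g0 where g0: "g0 \<in> T" "g0 i = m" by auto
      have "m < 0" using True m by force
      let ?T = "(\<lambda>g. g(i := 0)) ` {g \<in> T. g i = m}"
      let ?L = "{z \<in> L. z $ i = 0}"
      have "?T = {}"
      proof (rule Suc.hyps(1)[OF card_E, where L = ?L and c = "\<lambda>g. c (g(i := m))"])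
        show "vec.subspace ?L" using L by (rule subspace_coordinate_zero)
        show "finite ?T" using T by simp
        show "j \<in> ?E" if "g \<in> ?T" "g j < 0" for g j
          using that neg by (auto split: if_splits)
        show "\<exists>z\<in>?L. z $ e \<noteq> 0 \<and> (\<forall>b. g b < 0 \<and> ord e < ord b \<longrightarrow> z $ b = 0)"
          if g: "g \<in> ?T" and e: "e \<in> ?E" for g e
        proof -
          obtain h where h: "h \<in> T" "h i = m" "g = h(i := 0)" using g by auto
          obtain z where "z \<in> L" "z $ e \<noteq> 0" "\<forall>b. h b < 0 \<and> ord e < ord b \<longrightarrow> z $ b = 0"
            using witE[OF h(1), of e] e by blast
          then show ?thesis using h lt[OF e] \<open>m < 0\<close> by (intro bexI[of _ z]) auto
        qed
        show "\<exists>z\<in>?L. z $ k \<noteq> 0 \<and> (\<forall>j. g j < 0 \<or> ord k < ord j \<longrightarrow> z $ j = 0)"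
          if g: "g \<in> ?T" and k: "0 < g k" for g k
        proof -
          obtain h where h: "h \<in> T" "h i = m" "g = h(i := 0)" using g by auto
          then have "0 < h k" using k by (auto split: if_splits)
          then obtain z where "z \<in> L" "z $ k \<noteq> 0" "\<forall>j. h j < 0 \<or> ord k < ord j \<longrightarrow> z $ j = 0"
            using witC[OF h(1), of k] by blast
          then show ?thesis using h \<open>m < 0\<close> by (intro bexI[of _ z]) auto
        qed
        show "(\<Sum>g\<in>?T. c (g(i := m)) * laurent g z) = 0"
          if "z \<in> ?L" "\<And>j. j \<in> ?E \<Longrightarrow> z $ j \<noteq> 0" for z
        proof (rule laurent_relation_leading_part[where E = ?E and L = L and v = v])
          show "(\<Sum>g\<in>T. c g * laurent g z) = 0"
            if "z \<in> L" "\<And>j. j \<in> insert i ?E \<Longrightarrow> z $ j \<noteq> 0" for z using zero' that .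
          show "0 \<le> g j" if "g \<in> T" "j \<notin> insert i ?E" for g j using nonneg that .
        qed (use that inf L T v m in auto)
        show "c (g(i := m)) \<noteq> 0" if g: "g \<in> ?T" for g
        proof -
          obtain h where "h \<in> T" "h i = m" "g = h(i := 0)" using g by blast
          then show ?thesis using nz[of h] by (metis fun_upd_triv fun_upd_upd)
        qed
      qed
      then show False using g0 by blast
    next
      case False
      have "T = {}"
      proof (rule Suc.hyps(1)[OF card_E L T _ _ witC _ nz])
        show "j \<in> ?E" if "g \<in> T" "g j < 0" for g j using that neg False by auto
        show "\<exists>z\<in>L. z $ e \<noteq> 0 \<and> (\<forall>b. g b < 0 \<and> ord e < ord b \<longrightarrow> z $ b = 0)"
          if "g \<in> T" "e \<in> ?E" for g e using witE that by blast
        show "(\<Sum>g\<in>T. c g * laurent g z) = 0"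
          if "z \<in> L" "\<And>j. j \<in> ?E \<Longrightarrow> z $ j \<noteq> 0" for z
        proof -
          have "(\<Sum>g\<in>T. c g * laurent (g(i := g i - 0)) z) = 0"
          proof (rule laurent_relation_extends[where E = ?E and L = L and v = v])
            show "(\<Sum>g\<in>T. c g * laurent g z) = 0"
              if "z \<in> L" "\<And>j. j \<in> insert i ?E \<Longrightarrow> z $ j \<noteq> 0" for z using zero' that .
            show "0 \<le> g j" if "g \<in> T" "j \<notin> insert i ?E" for g j using nonneg that .
            show "0 \<le> g i" if "g \<in> T" for g using that False by force
          qed (use that inf L T v in auto)
          then show ?thesis by simp
        qed
      qed
      then show False using \<open>T \<noteq> {}\<close> by simp
    qed
  qed
qed

lemma laurent_independent:
  fixes L :: "('a::field ^ 'i::finite) set" and c :: "('i \<Rightarrow> int) \<Rightarrow> 'a" and ord :: "'i \<Rightarrow> nat"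
  assumes inf: "infinite (UNIV :: 'a set)" and "inj ord"
    and L: "vec.subspace L" and T: "finite T"
    and "\<And>g e. g \<in> T \<Longrightarrow> \<exists>z\<in>L. z $ e \<noteq> 0 \<and> (\<forall>b. g b < 0 \<and> ord e < ord b \<longrightarrow> z $ b = 0)"
    and "\<And>g i. g \<in> T \<Longrightarrow> 0 < g i \<Longrightarrow>
           \<exists>z\<in>L. z $ i \<noteq> 0 \<and> (\<forall>j. g j < 0 \<or> ord i < ord j \<longrightarrow> z $ j = 0)"
    and zero: "\<And>z. z \<in> L \<Longrightarrow> (\<And>j. z $ j \<noteq> 0) \<Longrightarrow> (\<Sum>g\<in>T. c g * laurent g z) = 0"
    and g: "g \<in> T"
  shows "c g = 0"
proof -
  let ?T = "{g \<in> T. c g \<noteq> 0}"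
  have "?T = {}"
  proof (rule laurent_independent_poles_within[OF inf \<open>inj ord\<close> L, where E = UNIV])
    show "(\<Sum>g\<in>?T. c g * laurent g z) = 0" if "z \<in> L" "\<And>j. j \<in> UNIV \<Longrightarrow> z $ j \<noteq> 0" for z
    proof -
      have "(\<Sum>g\<in>?T. c g * laurent g z) = (\<Sum>g\<in>T. c g * laurent g z)"
        using T by (intro sum.mono_neutral_left) auto
      then show ?thesis using zero that by simp
    qed
  qed (use assms in auto)
  then show ?thesis using g by blast
qed

section \<open>Spaces of linear forms\<close>

definition form_scale :: "'k::field \<Rightarrow> ('v \<Rightarrow> 'k) \<Rightarrow> 'v \<Rightarrow> 'k" where
  "form_scale c f = (\<lambda>v. c * f v)"

lemma vector_space_form_scale: "vector_space form_scale"
  by unfold_locales (auto simp: form_scale_def fun_eq_iff algebra_simps)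

locale form_arrangement = V: vector_space sc
  for sc :: "'k::field \<Rightarrow> 'v::ab_group_add \<Rightarrow> 'v" +
  fixes x :: "'i::finite \<Rightarrow> 'v \<Rightarrow> 'k" and ord :: "'i \<Rightarrow> nat"
  assumes linear_x: "Vector_Spaces.linear sc (*) (x i)"
    and inj_ord: "inj ord"
begin

sublocale forms: vector_family form_scale x ord
  by (intro vector_family.intro vector_space_form_scale vector_family_axioms.intro inj_ord)

lemma sum_form_scale: "(\<Sum>b\<in>S. form_scale (c b) (f b)) v = (\<Sum>b\<in>S. c b * f b v)"
  by (induction S rule: infinite_finite_induct) (auto simp: form_scale_def)

lemma matroid_of_forms_eq: "matroid_of_forms x = forms.family_matroid"
proof -
  have "C \<in> matroid_of_forms x \<longleftrightarrow>
      (\<forall>c. (\<Sum>i\<in>C. form_scale (c i) (x i)) = 0 \<longrightarrow> (\<forall>i\<in>C. c i = 0))" for C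
    unfolding matroid_of_forms_def by (simp add: fun_eq_iff sum_form_scale)
  then show ?thesis by (auto simp: forms.family_matroid_def forms.family_independent_iff)
qed

definition linear_form :: "('v \<Rightarrow> 'k) \<Rightarrow> bool" where
  "linear_form f \<longleftrightarrow> (\<forall>v w. f (v + w) = f v + f w) \<and> (\<forall>a v. f (sc a v) = a * f v)"

lemma linear_form_x: "linear_form (x i)"
proof -
  interpret Vector_Spaces.linear sc "(*)" "x i" by (rule linear_x)
  show ?thesis unfolding linear_form_def using add scale by auto
qed

lemma linear_form_diff: "linear_form f \<Longrightarrow> f (v - w) = f v - f w"
  unfolding linear_form_def by (metis add_diff_cancel_right' diff_add_cancel)

text \<open>
  In the induction step, the new form \<open>g\<close> is eliminated from \<open>f\<close> by means of a vector \<open>w\<close> with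
  \<open>g w \<noteq> 0\<close> on which the earlier forms vanish. If there is no such vector, \<open>g\<close> is a combination of the
  earlier forms and imposes no new condition.
\<close>

lemma separating_vector:
  assumes "finite S" "\<And>g. g \<in> S \<Longrightarrow> linear_form g" "linear_form f" "f \<notin> forms.span S"
  shows "\<exists>v. f v \<noteq> 0 \<and> (\<forall>g\<in>S. g v = 0)"
  using assms
proof (induction S arbitrary: f rule: finite_induct)
  case empty
  then have "f \<noteq> 0" by simp
  then show ?case by (auto simp: fun_eq_iff)
next
  case (insert g S)
  note lin_g = insert.prems(1)[OF insertI1]
  have f_S: "f \<notin> forms.span S"
    using insert.prems(3) forms.span_mono[of S "insert g S"] by blast
  show ?case
  proof (cases "g \<in> forms.span S")
    case True
    obtain v where v: "f v \<noteq> 0" "\<forall>h\<in>S. h v = 0"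
      using insert.IH[of f] insert.prems f_S by blast
    have "forms.span S \<subseteq> {h. h v = 0}"
      using v(2) by (intro forms.span_minimal forms.subspaceI) (auto simp: form_scale_def)
    then show ?thesis using v True by blast
  next
    case False
    then obtain w where w: "g w \<noteq> 0" "\<forall>h\<in>S. h w = 0"
      using insert.IH[of g] insert.prems by blast
    define a where "a = f w / g w"
    have "f - form_scale a g \<notin> forms.span S"
    proof
      assume "f - form_scale a g \<in> forms.span S"
      then have "f - form_scale a g \<in> forms.span (insert g S)"
        using forms.span_mono[of S "insert g S"] by blast
      moreover have "form_scale a g \<in> forms.span (insert g S)"
        by (intro forms.span_scale forms.span_base insertI1)
      ultimately have "(f - form_scale a g) + form_scale a g \<in> forms.span (insert g S)"
        by (rule forms.span_add)
      then show False using insert.prems(3) by simp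
    qed
    moreover have "linear_form (f - form_scale a g)"
      using lin_g insert.prems(2) unfolding linear_form_def form_scale_def
      by (simp add: algebra_simps)
    ultimately obtain v where v: "(f - form_scale a g) v \<noteq> 0" "\<forall>h\<in>S. h v = 0"
      using insert.IH insert.prems(1) by blast
    let ?v = "v - sc (g v / g w) w"
    have at: "h ?v = h v - g v / g w * h w" if "linear_form h" for h
      using that linear_form_diff[OF that] by (simp add: linear_form_def)
    have "f ?v \<noteq> 0"
      using v(1) at[OF insert.prems(2)] w(1) by (auto simp: form_scale_def a_def field_simps)
    moreover have "\<forall>h\<in>insert g S. h ?v = 0"
    proof
      fix h assume h: "h \<in> insert g S"
      have "h ?v = h v - g v / g w * h w" by (rule at[OF insert.prems(1)[OF h]])
      then show "h ?v = 0" using h v(2) w by auto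
    qed
    ultimately show ?thesis by blast
  qed
qed

lemma separating_vector_x:
  assumes "x e \<notin> forms.span (x ` S)"
  obtains v where "x e v \<noteq> 0" "\<And>b. b \<in> S \<Longrightarrow> x b v = 0"
  using separating_vector[of "x ` S" "x e"] assms linear_form_x by auto

text \<open>
  A basis of the span of the forms has a dual family of vectors, which is a basis of the space on which
  the forms live because the forms have no common zero other than \<open>0\<close>.
\<close>

lemma rank_eq_dim:
  assumes essential: "\<And>v. (\<And>i. x i v = 0) \<Longrightarrow> v = 0"
  shows "forms.rk UNIV = V.dim UNIV"
proof -
  obtain B where B: "B \<subseteq> range x" "forms.independent B" "range x \<subseteq> forms.span B"
      "card B = forms.dim (range x)"
    using forms.basis_exists by blast
  obtain D where D: "inj_on x D" "B = x ` D" using B(1) by (meson subset_image_inj)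
  have "\<exists>v. x i v = 1 \<and> (\<forall>j\<in>D - {i}. x j v = 0)" if i: "i \<in> D" for i
  proof -
    have "x i \<notin> forms.span (B - {x i})" using B(2) D i unfolding forms.dependent_def by blast
    moreover have "B - {x i} = x ` (D - {i})"
      using D i by (auto simp: inj_on_def)
    ultimately obtain v where v: "x i v \<noteq> 0" "\<And>b. b \<in> D - {i} \<Longrightarrow> x b v = 0"
      by (metis separating_vector_x)
    have "x i (sc (1 / x i v) v) = 1" "\<forall>j\<in>D - {i}. x j (sc (1 / x i v) v) = 0"
      using v linear_form_x unfolding linear_form_def by auto
    then show ?thesis by blast
  qed
  then obtain p where p: "\<And>i. i \<in> D \<Longrightarrow> x i (p i) = 1"
      "\<And>i j. i \<in> D \<Longrightarrow> j \<in> D \<Longrightarrow> j \<noteq> i \<Longrightarrow> x j (p i) = 0"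
    by (metis Diff_iff empty_iff insert_iff)
  have x_sum: "x j (\<Sum>i\<in>A. sc (c i) (q i)) = (\<Sum>i\<in>A. c i * x j (q i))" for j A c and q :: "'i \<Rightarrow> 'v"
  proof -
    interpret Vector_Spaces.linear sc "(*)" "x j" by (rule linear_x)
    show ?thesis by (simp add: sum scale)
  qed
  have coord: "x j (\<Sum>i\<in>D. sc (c i) (p i)) = c j" if "j \<in> D" for j c
  proof -
    have "x j (\<Sum>i\<in>D. sc (c i) (p i)) = (\<Sum>i\<in>D. if i = j then c i else 0)"
      unfolding x_sum using p that by (intro sum.cong) auto
    then show ?thesis using that by simp
  qed
  have "inj_on p D" using p by (metis inj_onI zero_neq_one)
  have "V.independent (p ` D)"
  proof (rule V.independent_if_scalars_zero)
    fix f w assume z: "(\<Sum>w\<in>p ` D. sc (f w) w) = 0" and "w \<in> p ` D"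
    then obtain j where j: "j \<in> D" "w = p j" by blast
    have "(\<Sum>i\<in>D. sc (f (p i)) (p i)) = 0" using z by (simp add: sum.reindex[OF \<open>inj_on p D\<close>])
    then have "f (p j) = x j 0" using coord[OF j(1), of "\<lambda>i. f (p i)"] by simp
    also have "x j 0 = 0" using linear_form_diff[OF linear_form_x, of j 0 0] by simp
    finally show "f w = 0" using j by simp
  qed simp
  moreover have "v \<in> V.span (p ` D)" for v
  proof -
    let ?w = "\<Sum>i\<in>D. sc (x i v) (p i)"
    have "x j (v - ?w) = 0" for j
    proof -
      have "x ` D \<subseteq> {h. h (v - ?w) = 0}"
        using coord linear_form_diff[OF linear_form_x] by auto
      then have "forms.span (x ` D) \<subseteq> {h. h (v - ?w) = 0}"
        by (intro forms.span_minimal forms.subspaceI) (auto simp: form_scale_def)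
      then show ?thesis using B(3) D(2) by blast
    qed
    then have "v - ?w = 0" by (rule essential)
    then have "v = ?w" by simp
    also have "\<dots> \<in> V.span (p ` D)"
      by (intro V.span_sum V.span_scale V.span_base) auto
    finally show ?thesis .
  qed
  ultimately have "V.dim UNIV = card (p ` D)"
    by (intro V.dim_unique) auto
  then show ?thesis using B(4) D \<open>inj_on p D\<close> by (simp add: forms.rk_def card_image)
qed

text \<open>
  This and the next lemma pass from the forms over \<open>'k\<close> to coordinates over the algebraic closure.
  Relations keep their coefficients in \<open>'k\<close>, which makes straightening possible over \<open>'k\<close>.
\<close>

lemma relation_on_linear_space:
  assumes "x e \<in> forms.span (x ` S)"
  obtains c where "\<And>z. z \<in> linear_space x \<Longrightarrow> z $ e = (\<Sum>b\<in>S. to_ac (c b) * z $ b)"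
proof -
  obtain c where c: "x e = (\<Sum>b\<in>S. form_scale (c b) (x b))"
    using forms.span_family_relation[OF finite assms] .
  have "z $ e = (\<Sum>b\<in>S. to_ac (c b) * z $ b)" if "z \<in> linear_space x" for z
    using that unfolding linear_space_def
  proof (induction rule: vec.span_induct_alt)
    case (step a z w)
    then obtain v where "z = (\<chi> i. to_ac (x i v))" by blast
    then have "z $ e = (\<Sum>b\<in>S. to_ac (c b) * z $ b)"
      using c by (simp add: sum_form_scale to_ac_sum)
    then show ?case using step.hyps step.IH
      by (simp add: algebra_simps sum.distrib sum_distrib_left)
  qed simp
  then show ?thesis using that by blast
qed

lemma witness_in_linear_space:
  assumes "x e \<notin> forms.span (x ` S)"
  shows "\<exists>z\<in>linear_space x. z $ e \<noteq> 0 \<and> (\<forall>b\<in>S. z $ b = 0)"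
proof -
  obtain v where "x e v \<noteq> 0" "\<And>b. b \<in> S \<Longrightarrow> x b v = 0" using separating_vector_x[OF assms] by blast
  then show ?thesis unfolding linear_space_def
    by (intro bexI[of _ "\<chi> i. to_ac (x i v)"] vec.span_base) auto
qed

end

section \<open>Straightening Laurent monomials\<close>

text \<open>
  The change of exponents when one factor $z_e$ is replaced by a factor $z_b$.
\<close>

definition move :: "'i \<Rightarrow> 'i \<Rightarrow> ('i \<Rightarrow> int) \<Rightarrow> 'i \<Rightarrow> int" where
  "move e b g = g(e := g e - 1, b := g b + 1)"

lemma laurent_move:
  assumes "b \<noteq> e" "\<And>i. z $ i \<noteq> 0"
  shows "laurent (move e b g) z * z $ e = laurent g z * z $ b"
proof -
  have "laurent (move e b g) z = (\<Prod>i\<in>UNIV. (if i = e then inverse (z $ i) else 1) *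
          ((if i = b then z $ i else 1) * z $ i powi g i))"
    unfolding laurent_def move_def using assms
    by (intro prod.cong) (auto simp: power_int_add power_int_diff divide_simps)
  then show ?thesis using assms by (simp add: prod.distrib laurent_def)
qed

lemma sum_move:
  fixes f :: "'i::finite \<Rightarrow> int \<Rightarrow> int"
  assumes "b \<noteq> e"
  shows "(\<Sum>i\<in>UNIV. f i (move e b g i)) =
           (\<Sum>i\<in>UNIV. f i (g i)) + (f e (g e - 1) - f e (g e)) + (f b (g b + 1) - f b (g b))"
proof -
  have "(\<Sum>i\<in>UNIV. f i (move e b g i)) = (\<Sum>i\<in>UNIV. f i (g i)
      + (if i = e then f i (g i - 1) - f i (g i) else 0)
      + (if i = b then f i (g i + 1) - f i (g i) else 0))"
    using assms by (intro sum.cong) (auto simp: move_def)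
  then show ?thesis by (simp add: sum.distrib)
qed

definition neg_degree :: "('i::finite \<Rightarrow> int) \<Rightarrow> int" where
  "neg_degree g = (\<Sum>i\<in>UNIV. max 0 (- g i))"

definition exponents :: "int \<Rightarrow> int \<Rightarrow> ('i::finite \<Rightarrow> int) set" where
  "exponents s d = {g. (\<Sum>i\<in>UNIV. g i) = s \<and> neg_degree g \<le> d}"

text \<open>
  The two constraints bound the degree of the positive part as well, hence every coordinate.
\<close>

lemma finite_exponents: "finite (exponents s d :: ('i::finite \<Rightarrow> int) set)"
proof -
  have "exponents s d \<subseteq> PiE (UNIV :: 'i set) (\<lambda>_. {- d..s + d})"
  proof
    fix g :: "'i \<Rightarrow> int" assume g: "g \<in> exponents s d"
    have "- d \<le> g i \<and> g i \<le> s + d" for i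
    proof
      have "max 0 (- g i) \<le> neg_degree g"
        unfolding neg_degree_def by (rule member_le_sum) auto
      then show "- d \<le> g i" using g by (simp add: exponents_def)
      have "max 0 (g i) \<le> (\<Sum>i\<in>UNIV. max 0 (g i))" by (rule member_le_sum) auto
      also have "\<dots> = (\<Sum>i\<in>UNIV. g i + max 0 (- g i))" by (intro sum.cong) auto
      also have "\<dots> = s + neg_degree g" using g by (simp add: sum.distrib neg_degree_def exponents_def)
      finally show "g i \<le> s + d" using g by (simp add: exponents_def)
    qed
    then show "g \<in> PiE UNIV (\<lambda>_. {- d..s + d})" by (auto simp: PiE_def)
  qed
  then show ?thesis by (rule finite_subset) (simp add: finite_PiE)
qed

text \<open>
  Functions with values in the algebraic closure are regarded as a vector space over \<open>'k\<close>, the field over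
  which the Hilbert function is defined.
\<close>

definition ac_scale :: "'k::field \<Rightarrow> ('z \<Rightarrow> 'k alg_closure) \<Rightarrow> 'z \<Rightarrow> 'k alg_closure" where
  "ac_scale c f = (\<lambda>z. to_ac c * f z)"

lemma vector_space_ac_scale: "vector_space ac_scale"
  by unfold_locales (auto simp: ac_scale_def fun_eq_iff algebra_simps)

interpretation ac: vector_space ac_scale
  by (rule vector_space_ac_scale)

lemma sum_ac_scale: "(\<Sum>b\<in>S. ac_scale (c b) (f b)) z = (\<Sum>b\<in>S. to_ac (c b) * f b z)"
  by (induction S rule: infinite_finite_induct) (auto simp: ac_scale_def)

lemma infinite_alg_closed_field: "infinite (UNIV :: 'a::alg_closed_field set)"
proof
  assume fin: "finite (UNIV :: 'a set)"
  define p where "p = (\<Prod>a\<in>(UNIV :: 'a set). [:- a, 1:]) + 1"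
  have "degree (\<Prod>a\<in>(UNIV :: 'a set). [:- a, 1:]) = card (UNIV :: 'a set)"
    by (simp add: degree_prod_eq_sum_degree)
  moreover have "0 < card (UNIV :: 'a set)" using fin by (simp add: card_gt_0_iff)
  ultimately have "degree p > 0" unfolding p_def by (simp add: degree_add_eq_left)
  then obtain a where "poly p a = 0" using alg_closed_imp_poly_has_root by blast
  moreover have "poly p a = 1" using fin by (simp add: p_def poly_prod)
  ultimately show False by simp
qed

context form_arrangement
begin

text \<open>
  The exponents of the monomials to which no straightening relation applies.
\<close>

definition standard :: "('i \<Rightarrow> int) \<Rightarrow> bool" where
  "standard g \<longleftrightarrow> forms.nbc {i. g i < 0} \<and>
     (\<forall>i. 0 < g i \<longrightarrow> i \<in> forms.compl_basis {i. g i < 0})"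

text \<open>
  Extension by \<open>0\<close> lets functions on the complement be added within a full function space.
\<close>

definition laurent_fun :: "('i \<Rightarrow> int) \<Rightarrow> 'k alg_closure ^ 'i \<Rightarrow> 'k alg_closure" where
  "laurent_fun g = (\<lambda>z. if z \<in> linear_complement x then laurent g z else 0)"

lemma laurent_fun_move:
  assumes "x e \<in> forms.span (x ` S)" "e \<notin> S"
  obtains c where "laurent_fun g = (\<Sum>b\<in>S. ac_scale (c b) (laurent_fun (move e b g)))"
proof -
  obtain c where c: "\<And>z. z \<in> linear_space x \<Longrightarrow> z $ e = (\<Sum>b\<in>S. to_ac (c b) * z $ b)"
    using relation_on_linear_space[OF assms(1)] by blast
  have "laurent_fun g z = (\<Sum>b\<in>S. to_ac (c b) * laurent_fun (move e b g) z)" for z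
  proof (cases "z \<in> linear_complement x")
    case True
    then have z: "z \<in> linear_space x" "\<And>i. z $ i \<noteq> 0" by (auto simp: linear_complement_def)
    have "laurent g z * z $ e = (\<Sum>b\<in>S. to_ac (c b) * (laurent g z * z $ b))"
      by (subst c[OF z(1)]) (simp add: sum_distrib_left mult_ac)
    also have "\<dots> = (\<Sum>b\<in>S. to_ac (c b) * (laurent (move e b g) z * z $ e))"
      using assms(2) z(2) by (intro sum.cong refl) (subst laurent_move, auto)
    also have "\<dots> = (\<Sum>b\<in>S. to_ac (c b) * laurent (move e b g) z) * z $ e"
      by (subst sum_distrib_right) (simp add: mult_ac)
    finally show ?thesis using True z(2) by (simp add: laurent_fun_def)
  qed (simp add: laurent_fun_def)
  then show ?thesis using that[of c] by (auto simp: fun_eq_iff sum_ac_scale)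
qed

text \<open>
  The last condition states what straightening achieves. Either a pole of the monomial is cancelled and
  none is created, or the number of poles is unchanged and a factor moves to a larger index. In the latter
  case a pole at \<open>b\<close> becomes one at \<open>e\<close>, or a zero at \<open>e\<close> becomes one at \<open>b\<close>.
\<close>

lemma not_standard_reducible:
  assumes "\<not> standard g"
  obtains e S where "x e \<in> forms.span (x ` S)" "e \<notin> S"
    and "\<forall>b\<in>S. (g b < 0 \<and> 0 < g e) \<or> (ord e < ord b \<and> (g b < 0 \<longleftrightarrow> g e \<le> 0))"
proof (cases "forms.nbc {i. g i < 0}")
  case True
  then obtain e where e: "0 < g e" "e \<notin> forms.compl_basis {i. g i < 0}"
    using assms by (auto simp: standard_def)
  show ?thesis
  proof (rule that)
    show "x e \<in> forms.span (x ` ({i. g i < 0} \<union> {j. ord e < ord j}))"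
      using e by (simp add: forms.compl_basis_def)
  qed (use e in auto)
next
  case False
  then obtain e where e: "x e \<in> forms.span (x ` {b \<in> {i. g i < 0}. ord e < ord b})"
    by (auto simp: forms.nbc_def)
  show ?thesis by (rule that[OF e]) auto
qed

lemma straightening:
  assumes "g \<in> exponents s d"
  shows "laurent_fun g \<in> ac.span (laurent_fun ` {g \<in> exponents s d. standard g})"
proof -
  \<comment> \<open>When the number of poles does not drop, this weight increases; it is bounded on the finite set of admissible exponents.\<close>
  define w where "w g = (\<Sum>i\<in>UNIV. int (ord i) * g i)" for g
  define W where "W = Max (w ` exponents s d)"
  have W: "w g \<le> W" if "g \<in> exponents s d" for g
    unfolding W_def using that finite_exponents by (intro Max_ge) auto
  let ?r = "inv_image (less_than <*lex*> less_than) (\<lambda>g. (nat (neg_degree g), nat (W - w g)))"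
  have "wf ?r" by (intro wf_inv_image wf_lex_prod wf_less_than)
  then show ?thesis using assms
  proof (induction g rule: wf_induct_rule)
    case (less g)
    show ?case
    proof (cases "standard g")
      case True
      then show ?thesis using less.prems by (intro ac.span_base) auto
    next
      case False
      then obtain e S where eS: "x e \<in> forms.span (x ` S)" "e \<notin> S"
        and red: "\<forall>b\<in>S. (g b < 0 \<and> 0 < g e) \<or> (ord e < ord b \<and> (g b < 0 \<longleftrightarrow> g e \<le> 0))"
        by (rule not_standard_reducible)
      have "laurent_fun (move e b g) \<in> ac.span (laurent_fun ` {g \<in> exponents s d. standard g})"
        if b: "b \<in> S" for b
      proof (rule less.IH)
        have "b \<noteq> e" using eS(2) b by blast
        note sum_move = sum_move[OF this]
        have nd: "neg_degree (move e b g) = neg_degree g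
            + (if g e \<le> 0 then 1 else 0) - (if g b < 0 then 1 else 0)"
          unfolding neg_degree_def sum_move[of "\<lambda>i n. max 0 (- n)" g] by auto
        have wt: "w (move e b g) = w g + int (ord b) - int (ord e)"
          unfolding w_def sum_move[of "\<lambda>i n. int (ord i) * n" g] by (simp add: algebra_simps)
        have "(\<Sum>i\<in>UNIV. move e b g i) = (\<Sum>i\<in>UNIV. g i)"
          using sum_move[of "\<lambda>i n. n" g] by simp
        then show mem: "move e b g \<in> exponents s d"
          using less.prems nd bspec[OF red b] by (auto simp: exponents_def split: if_splits)
        have "0 \<le> neg_degree (move e b g)" by (auto simp: neg_degree_def intro: sum_nonneg)
        then show "(move e b g, g) \<in> ?r"
          using bspec[OF red b] nd wt W[OF mem] by (auto split: if_splits)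
      qed
      moreover obtain c where "laurent_fun g = (\<Sum>b\<in>S. ac_scale (c b) (laurent_fun (move e b g)))"
        using laurent_fun_move[OF eS] .
      ultimately show ?thesis by (auto intro: ac.span_sum ac.span_scale)
    qed
  qed
qed

lemma standard_independent:
  assumes "finite T" "\<And>g. g \<in> T \<Longrightarrow> standard g"
    and zero: "(\<Sum>g\<in>T. ac_scale (c g) (laurent_fun g)) = 0" and g: "g \<in> T"
  shows "c g = 0"
proof -
  have "to_ac (c g) = 0"
  proof (rule laurent_independent[OF infinite_alg_closed_field inj_ord _ \<open>finite T\<close> _ _ _ g])
    show "vec.subspace (linear_space x)" by (simp add: linear_space_def)
    show "\<exists>z\<in>linear_space x. z $ e \<noteq> 0 \<and> (\<forall>b. g b < 0 \<and> ord e < ord b \<longrightarrow> z $ b = 0)"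
      if "g \<in> T" for g e
      using witness_in_linear_space[of e "{b \<in> {i. g i < 0}. ord e < ord b}"] assms(2)[OF that]
      by (simp add: standard_def forms.nbc_def)
    show "\<exists>z\<in>linear_space x. z $ i \<noteq> 0 \<and> (\<forall>j. g j < 0 \<or> ord i < ord j \<longrightarrow> z $ j = 0)"
      if "g \<in> T" "0 < g i" for g i
    proof -
      have "x i \<notin> forms.span (x ` ({j. g j < 0} \<union> {j. ord i < ord j}))"
        using assms(2)[OF that(1)] that(2) by (simp add: standard_def forms.compl_basis_def)
      then obtain z where "z \<in> linear_space x" "z $ i \<noteq> 0"
          "\<forall>j\<in>{j. g j < 0} \<union> {j. ord i < ord j}. z $ j = 0"
        using witness_in_linear_space by blast
      then show ?thesis by (intro bexI[of _ z]) auto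
    qed
    show "(\<Sum>g\<in>T. to_ac (c g) * laurent g z) = 0"
      if "z \<in> linear_space x" "\<And>j. z $ j \<noteq> 0" for z
    proof -
      have "z \<in> linear_complement x" using that by (simp add: linear_complement_def)
      moreover have "(\<Sum>g\<in>T. to_ac (c g) * laurent_fun g z) = 0"
        using fun_cong[OF zero, of z] by (simp add: sum_ac_scale)
      ultimately show ?thesis by (simp add: laurent_fun_def)
    qed
  qed
  then show ?thesis by simp
qed

end

section \<open>The dimension of a quotient\<close>

text \<open>
  If the quotient of \<open>W\<close> by \<open>U\<close> is identified with a space of functions by a linear map \<open>f\<close>, a basis of
  that space determines the dimension: sets of representatives of bases of the quotient are exactly the
  sets on which \<open>f\<close> is injective with image a basis of \<open>f ` W\<close>.
\<close>

lemma quotient_dim_eqI: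
  assumes "vector_space st" and sum_W: "\<And>B c. B \<subseteq> W \<Longrightarrow> (\<Sum>b\<in>B. sc (c b) b) \<in> W"
    and diff_W: "\<And>v w. v \<in> W \<Longrightarrow> w \<in> W \<Longrightarrow> v - w \<in> W"
    and f_diff: "\<And>v w. f (v - w) = f v - f w"
    and f_sum: "\<And>B c. f (\<Sum>b\<in>B. sc (c b) b) = (\<Sum>b\<in>B. st (c b) (f b))"
    and ker: "\<And>w. w \<in> W \<Longrightarrow> w \<in> U \<longleftrightarrow> f w = 0"
    and J: "finite J" and e: "\<And>j. j \<in> J \<Longrightarrow> e j \<in> f ` W"
    and indep: "\<And>c j. (\<Sum>j\<in>J. st (c j) (e j)) = 0 \<Longrightarrow> j \<in> J \<Longrightarrow> c j = 0"
    and span: "f ` W \<subseteq> module.span st (e ` J)"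
  shows "quotient_dim sc W U = card J"
proof -
  interpret vector_space st by fact
  have eJ: "inj_on e J" "independent (e ` J)"
    using family_independent_iff[OF J, of e] indep by blast+
  have dim: "card J = dim (f ` W)"
    using basis_card_eq_dim[of "e ` J" "f ` W"] e span eJ by (auto simp: card_image)
  show ?thesis
    unfolding quotient_dim_def
  proof (rule the_equality)
    have "\<forall>j\<in>J. \<exists>w. w \<in> W \<and> f w = e j"
    proof
      fix j assume "j \<in> J"
      from e[OF this] show "\<exists>w. w \<in> W \<and> f w = e j" by (elim imageE) auto
    qed
    from bchoice[OF this] obtain m where m: "\<And>j. j \<in> J \<Longrightarrow> m j \<in> W \<and> f (m j) = e j" by blast
    have inj_m: "inj_on m J"
    proof (rule inj_onI)
      fix i j assume "i \<in> J" "j \<in> J" "m i = m j"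
      then have "e i = e j" using m[of i] m[of j] by simp
      then show "i = j" using inj_onD[OF eJ(1)] \<open>i \<in> J\<close> \<open>j \<in> J\<close> by blast
    qed
    have sum_m: "f (\<Sum>b\<in>m ` J. sc (c b) b) = (\<Sum>j\<in>J. st (c (m j)) (e j))" for c
      unfolding f_sum unfolding sum.reindex[OF inj_m] o_def using m by (intro sum.cong) auto
    have mem: "(\<Sum>b\<in>m ` J. sc (c b) b) \<in> W" for c using m by (intro sum_W) auto
    show "\<exists>B\<subseteq>W. finite B \<and> card B = card J \<and>
        (\<forall>c. (\<Sum>b\<in>B. sc (c b) b) \<in> U \<longrightarrow> (\<forall>b\<in>B. c b = 0)) \<and>
        (\<forall>w\<in>W. \<exists>c. w - (\<Sum>b\<in>B. sc (c b) b) \<in> U)"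
    proof (intro exI[of _ "m ` J"] conjI allI impI ballI)
      show "m ` J \<subseteq> W" using m by auto
      show "finite (m ` J)" "card (m ` J) = card J" using J inj_m by (auto simp: card_image)
      fix c b assume "(\<Sum>b\<in>m ` J. sc (c b) b) \<in> U" and b: "b \<in> m ` J"
      then have "(\<Sum>j\<in>J. st (c (m j)) (e j)) = 0" using ker[OF mem] sum_m by simp
      then have "c (m j) = 0" if "j \<in> J" for j using indep[of "\<lambda>j. c (m j)" j] that by blast
      then show "c b = 0" using b by blast
    next
      fix w assume w: "w \<in> W"
      have "f w \<in> span (e ` J)" using w span by blast
      from span_family_relation[OF J this] obtain c where c: "f w = (\<Sum>j\<in>J. st (c j) (e j))" .
      let ?c = "\<lambda>b. c (inv_into J m b)"
      have "f (w - (\<Sum>b\<in>m ` J. sc (?c b) b)) = 0"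
        unfolding f_diff sum_m c using inj_m by simp
      then have "w - (\<Sum>b\<in>m ` J. sc (?c b) b) \<in> U" by (rule ker[OF diff_W[OF w mem], THEN iffD2])
      then show "\<exists>c. w - (\<Sum>b\<in>m ` J. sc (c b) b) \<in> U" by (intro exI[of _ ?c])
    qed
  next
    fix d assume "\<exists>B\<subseteq>W. finite B \<and> card B = d \<and>
        (\<forall>c. (\<Sum>b\<in>B. sc (c b) b) \<in> U \<longrightarrow> (\<forall>b\<in>B. c b = 0)) \<and>
        (\<forall>w\<in>W. \<exists>c. w - (\<Sum>b\<in>B. sc (c b) b) \<in> U)" (is "\<exists>B. ?P B")
    then obtain B where P: "?P B" by (rule exE)
    have B: "B \<subseteq> W" "finite B" "card B = d" using P by simp_all
    have indep_B: "c b = 0" if "(\<Sum>b\<in>B. sc (c b) b) \<in> U" "b \<in> B" for c b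
      using P that by (elim conjE) (drule spec[of _ c], drule mp, assumption, erule bspec)
    have span_B: "\<exists>c. w - (\<Sum>b\<in>B. sc (c b) b) \<in> U" if "w \<in> W" for w
      using P that by (elim conjE) (erule bspec)
    have "\<forall>c. (\<Sum>b\<in>B. st (c b) (f b)) = 0 \<longrightarrow> (\<forall>b\<in>B. c b = 0)"
    proof (intro allI impI ballI)
      fix c b assume "(\<Sum>b\<in>B. st (c b) (f b)) = 0" and b: "b \<in> B"
      then have "(\<Sum>b\<in>B. sc (c b) b) \<in> U" using ker[OF sum_W[OF B(1)]] f_sum by simp
      then show "c b = 0" using b by (rule indep_B)
    qed
    then have fB: "inj_on f B" "independent (f ` B)"
      using family_independent_iff[OF B(2), of f] by blast+
    have "f w \<in> span (f ` B)" if w: "w \<in> W" for w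
    proof -
      obtain c where c: "w - (\<Sum>b\<in>B. sc (c b) b) \<in> U" using span_B[OF w] by (rule exE)
      then have "f (w - (\<Sum>b\<in>B. sc (c b) b)) = 0" by (rule ker[OF diff_W[OF w sum_W[OF B(1)]], THEN iffD1])
      then have "f w = (\<Sum>b\<in>B. st (c b) (f b))" by (simp add: f_diff f_sum)
      then show ?thesis by (auto intro: span_sum span_scale span_base)
    qed
    then have "card (f ` B) = dim (f ` W)"
      using B(1) fB(2) by (intro basis_card_eq_dim) auto
    then show "d = card J" using dim B(3) fB(1) by (simp add: card_image)
  qed
qed

section \<open>Evaluation of bihomogeneous polynomials\<close>

definition monomial_at :: "('i::finite + 'i \<Rightarrow>\<^sub>0 nat) \<Rightarrow> 'a::field ^ 'i \<Rightarrow> 'a ^ 'i \<Rightarrow> 'a" where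
  "monomial_at m z w = (\<Prod>i\<in>UNIV. (z $ i) ^ Poly_Mapping.lookup m (Inl i)) *
                       (\<Prod>i\<in>UNIV. (w $ i) ^ Poly_Mapping.lookup m (Inr i))"

lemma monomial_at_add: "monomial_at (m + m') z w = monomial_at m z w * monomial_at m' z w"
  by (simp add: monomial_at_def lookup_add power_add prod.distrib)

lemma eval_bipoly_eq_sum:
  "eval_bipoly f z w = (\<Sum>m\<in>Poly_Mapping.keys f. to_ac (Poly_Mapping.lookup f m) * monomial_at m z w)"
  by (simp add: eval_bipoly_def monomial_at_def mult.assoc)

lemma eval_bipoly_superset:
  assumes "finite A" "Poly_Mapping.keys f \<subseteq> A"
  shows "eval_bipoly f z w = (\<Sum>m\<in>A. to_ac (Poly_Mapping.lookup f m) * monomial_at m z w)"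
  unfolding eval_bipoly_eq_sum
  using assms by (intro sum.mono_neutral_left) (auto simp: in_keys_iff)

lemma eval_bipoly_add: "eval_bipoly (f + g) z w = eval_bipoly f z w + eval_bipoly g z w"
  using keys_add[of f g]
  by (simp add: eval_bipoly_superset[of "Poly_Mapping.keys f \<union> Poly_Mapping.keys g"]
      lookup_add distrib_right sum.distrib)

lemma eval_bipoly_0 [simp]: "eval_bipoly 0 z w = 0"
  by (simp add: eval_bipoly_def)

lemma eval_bipoly_diff: "eval_bipoly (f - g) z w = eval_bipoly f z w - eval_bipoly g z w"
  using eval_bipoly_add[of "f - g" g z w] by simp

lemma eval_bipoly_sum: "eval_bipoly (\<Sum>a\<in>A. f a) z w = (\<Sum>a\<in>A. eval_bipoly (f a) z w)"
  by (induction A rule: infinite_finite_induct) (auto simp: eval_bipoly_add)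

lemma eval_bipoly_single: "eval_bipoly (Poly_Mapping.single m c) z w = to_ac c * monomial_at m z w"
  by (subst eval_bipoly_superset[of "{m}"]) (auto split: if_splits)

lemma bipoly_sum_singles:
  "f = (\<Sum>m\<in>Poly_Mapping.keys f. Poly_Mapping.single m (Poly_Mapping.lookup f m))"
proof (rule poly_mapping_eqI)
  fix n
  have "Poly_Mapping.lookup (\<Sum>m\<in>Poly_Mapping.keys f. Poly_Mapping.single m (Poly_Mapping.lookup f m)) n
      = (\<Sum>m\<in>Poly_Mapping.keys f. if m = n then Poly_Mapping.lookup f m else 0)"
    by (simp add: lookup_sum lookup_single when_def)
  then show "Poly_Mapping.lookup f n
      = Poly_Mapping.lookup (\<Sum>m\<in>Poly_Mapping.keys f. Poly_Mapping.single m (Poly_Mapping.lookup f m)) n"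
    by (simp add: in_keys_iff)
qed

lemma eval_bipoly_mult: "eval_bipoly (f * g) z w = eval_bipoly f z w * eval_bipoly g z w"
proof -
  have "f * g = (\<Sum>m\<in>Poly_Mapping.keys f. Poly_Mapping.single m (Poly_Mapping.lookup f m)) *
                (\<Sum>n\<in>Poly_Mapping.keys g. Poly_Mapping.single n (Poly_Mapping.lookup g n))"
    using bipoly_sum_singles[of f] bipoly_sum_singles[of g] by simp
  then have "eval_bipoly (f * g) z w =
      (\<Sum>m\<in>Poly_Mapping.keys f. to_ac (Poly_Mapping.lookup f m) * monomial_at m z w) *
      (\<Sum>n\<in>Poly_Mapping.keys g. to_ac (Poly_Mapping.lookup g n) * monomial_at n z w)"
    by (simp add: sum_product mult_single eval_bipoly_sum eval_bipoly_single monomial_at_add mult_ac)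
  then show ?thesis by (simp add: eval_bipoly_eq_sum)
qed

lemma monomial_at_scale:
  "monomial_at m (c *s z) (d *s w) =
     c ^ (\<Sum>i\<in>UNIV. Poly_Mapping.lookup m (Inl i)) * d ^ (\<Sum>i\<in>UNIV. Poly_Mapping.lookup m (Inr i)) *
     monomial_at m z w"
  by (simp add: monomial_at_def power_mult_distrib prod.distrib power_sum mult_ac)

lemma eval_bihomogeneous_scale:
  assumes "bihomogeneous a b f"
  shows "eval_bipoly f (c *s z) (d *s w) = c ^ a * d ^ b * eval_bipoly f z w"
proof -
  have "to_ac (Poly_Mapping.lookup f m) * monomial_at m (c *s z) (d *s w)
      = c ^ a * d ^ b * (to_ac (Poly_Mapping.lookup f m) * monomial_at m z w)"
    if "m \<in> Poly_Mapping.keys f" for m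
    using assms that unfolding monomial_at_scale bihomogeneous_def by (simp add: mult_ac)
  then show ?thesis
    unfolding eval_bipoly_eq_sum sum_distrib_left by (intro sum.cong refl)
qed

lemma bihomogeneous_add: "bihomogeneous a b f \<Longrightarrow> bihomogeneous a b g \<Longrightarrow> bihomogeneous a b (f + g)"
  unfolding bihomogeneous_def using keys_add[of f g] by blast

lemma bihomogeneous_scale: "bihomogeneous a b f \<Longrightarrow> bihomogeneous a b (Poly_Mapping.single 0 c * f)"
  unfolding bihomogeneous_def using keys_mult[of "Poly_Mapping.single 0 c" f] 
  by (auto split: if_splits)

lemma bihomogeneous_diff: "bihomogeneous a b f \<Longrightarrow> bihomogeneous a b g \<Longrightarrow> bihomogeneous a b (f - g)"
  unfolding bihomogeneous_def by (auto simp: in_keys_iff lookup_minus)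

section \<open>The vanishing ideal of the reciprocal graph\<close>

definition reciprocal :: "'a::field ^ 'i \<Rightarrow> 'a ^ 'i" where
  "reciprocal z = (\<chi> i. inverse (z $ i))"

lemma proj_class_self: "z \<in> proj_class z"
  unfolding proj_class_def by (auto intro!: exI[of _ 1])

text \<open>
  Taking the closure of the graph does not change the vanishing bihomogeneous polynomials, since the zero
  set of one such polynomial is closed. Passing to the generated ideal does not add any in the given
  bidegree either, because evaluation at a pair of representatives is a ring homomorphism.
\<close>

lemma in_vanishing_ideal_iff:
  fixes x :: "'i::finite \<Rightarrow> 'v \<Rightarrow> 'k::field"
  assumes "bihomogeneous a b f"
  shows "f \<in> vanishing_ideal (reciprocal_graph x) \<longleftrightarrow>
           (\<forall>z\<in>linear_complement x. eval_bipoly f z (reciprocal z) = 0)"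
proof
  interpret M: Modules.module "(*) :: (('i, 'k) bipoly \<Rightarrow> _)"
    by unfold_locales (simp_all add: algebra_simps)
  let ?G = "{(proj_class z, proj_class (\<chi> i. inverse (z $ i))) |z. z \<in> linear_complement x}"
  have graph: "(proj_class z, proj_class (reciprocal z)) \<in> reciprocal_graph x"
    if "z \<in> linear_complement x" for z
    unfolding reciprocal_graph_def reciprocal_def using that by (intro hull_inc) blast
  let ?K = "{f. \<forall>z\<in>linear_complement x. eval_bipoly f z (reciprocal z) = 0}"
  assume "f \<in> vanishing_ideal (reciprocal_graph x)"
  moreover have "vanishing_ideal (reciprocal_graph x) \<subseteq> ?K"
    unfolding vanishing_ideal_def
  proof (rule M.span_minimal)
    show "M.subspace ?K"
      by (rule M.subspaceI) (auto simp: eval_bipoly_add eval_bipoly_mult)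
    show "{f. (\<exists>a b. bihomogeneous a b f) \<and> (\<forall>p\<in>reciprocal_graph x. vanishes_at f p)} \<subseteq> ?K"
    proof (intro subsetI CollectI ballI)
      fix f z assume f: "f \<in> {f. (\<exists>a b. bihomogeneous a b f) \<and> (\<forall>p\<in>reciprocal_graph x. vanishes_at f p)}"
        and "z \<in> linear_complement x"
      then have "vanishes_at f (proj_class z, proj_class (reciprocal z))" using graph by blast
      then show "eval_bipoly f z (reciprocal z) = 0"
        unfolding vanishes_at_def using proj_class_self by auto
    qed
  qed
  ultimately show "\<forall>z\<in>linear_complement x. eval_bipoly f z (reciprocal z) = 0" by blast
next
  interpret M: Modules.module "(*) :: (('i, 'k) bipoly \<Rightarrow> _)"
    by unfold_locales (simp_all add: algebra_simps)
  assume zero: "\<forall>z\<in>linear_complement x. eval_bipoly f z (reciprocal z) = 0"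
  let ?Z = "{p \<in> proj_space \<times> proj_space. \<forall>f\<in>{f}. vanishes_at f p}"
  have "reciprocal_graph x \<subseteq> ?Z"
    unfolding reciprocal_graph_def
  proof (rule hull_minimal)
    show "biproj_closed ?Z" unfolding biproj_closed_def using assms by (intro exI[of _ "{f}"]) blast
    show "{(proj_class z, proj_class (\<chi> i. inverse (z $ i))) |z. z \<in> linear_complement x} \<subseteq> ?Z"
    proof
      fix p assume "p \<in> {(proj_class z, proj_class (\<chi> i. inverse (z $ i))) |z. z \<in> linear_complement x}"
      then obtain z where z: "z \<in> linear_complement x" "p = (proj_class z, proj_class (reciprocal z))"
        unfolding reciprocal_def by blast
      have "z \<noteq> 0" "reciprocal z \<noteq> 0"
        using z(1) by (auto simp: linear_complement_def reciprocal_def vec_eq_iff)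
      moreover have "vanishes_at f p"
        unfolding vanishes_at_def z(2) proj_class_def
        using zero z(1) by (auto simp: eval_bihomogeneous_scale[OF assms])
      ultimately show "p \<in> ?Z" using z(2) by (auto simp: proj_space_def)
    qed
  qed
  then show "f \<in> vanishing_ideal (reciprocal_graph x)"
    unfolding vanishing_ideal_def using assms by (intro M.span_base) blast
qed

section \<open>The Hilbert function counts standard exponents\<close>

definition exponent_diff :: "('i + 'i \<Rightarrow>\<^sub>0 nat) \<Rightarrow> 'i \<Rightarrow> int" where
  "exponent_diff m i = int (Poly_Mapping.lookup m (Inl i)) - int (Poly_Mapping.lookup m (Inr i))"

lemma monomial_at_reciprocal:
  assumes "\<And>i. z $ i \<noteq> 0"
  shows "monomial_at m z (reciprocal z) = laurent (exponent_diff m) z"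
  unfolding monomial_at_def laurent_def reciprocal_def exponent_diff_def prod.distrib[symmetric]
  using assms by (intro prod.cong) (auto simp: power_int_diff field_simps)

lemma exponent_diff_in_exponents:
  assumes "bihomogeneous a b f" "m \<in> Poly_Mapping.keys f"
  shows "exponent_diff m \<in> exponents (int a - int b) (int b)"
proof -
  have ab: "a = (\<Sum>i\<in>UNIV. Poly_Mapping.lookup m (Inl i))" "b = (\<Sum>i\<in>UNIV. Poly_Mapping.lookup m (Inr i))"
    using assms by (auto simp: bihomogeneous_def)
  have "neg_degree (exponent_diff m) \<le> (\<Sum>i\<in>UNIV. int (Poly_Mapping.lookup m (Inr i)))"
    unfolding neg_degree_def exponent_diff_def by (intro sum_mono) auto
  then show ?thesis
    by (simp add: exponents_def exponent_diff_def sum_subtractf ab)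
qed

text \<open>
  The positive and negative parts of \<open>g\<close> form a monomial whose bidegree may be too small by the same
  amount \<open>k\<close> in both entries; a factor $(x_{i_0} y_{i_0})^k$, which has value \<open>1\<close> at every pair
  $(z, z^{-1})$, makes up for it.
\<close>

lemma exponent_diff_surj:
  fixes g :: "'i::finite \<Rightarrow> int"
  assumes "g \<in> exponents (int a - int b) (int b)"
  obtains m where "bihomogeneous a b (Poly_Mapping.single m (1 :: 'k::field))" "exponent_diff m = g"
proof -
  obtain i0 :: 'i where True by blast
  define k where "k = nat (int b - neg_degree g)"
  define m where "m = Abs_poly_mapping (\<lambda>j. case j of
      Inl i \<Rightarrow> nat (g i) + (if i = i0 then k else 0)
    | Inr i \<Rightarrow> nat (- g i) + (if i = i0 then k else 0))"
  have lookup_m: "Poly_Mapping.lookup m (Inl i) = nat (g i) + (if i = i0 then k else 0)"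
      "Poly_Mapping.lookup m (Inr i) = nat (- g i) + (if i = i0 then k else 0)" for i
    by (simp_all add: m_def)
  have neg: "int (\<Sum>i\<in>UNIV. nat (- g i)) = neg_degree g"
    unfolding neg_degree_def of_nat_sum by (intro sum.cong) auto
  have k: "int k = int b - neg_degree g" using assms by (simp add: k_def exponents_def)
  have "int (\<Sum>i\<in>UNIV. nat (g i)) = (\<Sum>i\<in>UNIV. g i + max 0 (- g i))"
    unfolding of_nat_sum by (intro sum.cong) auto
  also have "\<dots> = int a - int b + neg_degree g"
    using assms by (simp add: sum.distrib exponents_def neg_degree_def)
  finally have pos: "int (\<Sum>i\<in>UNIV. nat (g i)) = int a - int b + neg_degree g" .
  have "(\<Sum>i\<in>UNIV. nat (g i)) + k = a" "(\<Sum>i\<in>UNIV. nat (- g i)) + k = b"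
    unfolding of_nat_eq_iff[where 'a = int, symmetric] of_nat_add using neg pos k by simp_all
  then have "(\<Sum>i\<in>UNIV. Poly_Mapping.lookup m (Inl i)) = a"
      "(\<Sum>i\<in>UNIV. Poly_Mapping.lookup m (Inr i)) = b"
    by (simp_all add: lookup_m sum.distrib)
  then have "bihomogeneous a b (Poly_Mapping.single m (1 :: 'k))" by (simp add: bihomogeneous_def)
  moreover have "exponent_diff m = g" by (auto simp: exponent_diff_def lookup_m)
  ultimately show ?thesis using that by blast
qed

context form_arrangement
begin

definition restricted_eval :: "('i, 'k) bipoly \<Rightarrow> 'k alg_closure ^ 'i \<Rightarrow> 'k alg_closure" where
  "restricted_eval f = (\<lambda>z. if z \<in> linear_complement x then eval_bipoly f z (reciprocal z) else 0)"

lemma restricted_eval_single: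
  "restricted_eval (Poly_Mapping.single m c) = ac_scale c (laurent_fun (exponent_diff m))"
  by (auto simp: restricted_eval_def ac_scale_def laurent_fun_def fun_eq_iff eval_bipoly_single
      monomial_at_reciprocal linear_complement_def)

lemma restricted_eval_add: "restricted_eval (f + g) = restricted_eval f + restricted_eval g"
  by (auto simp: restricted_eval_def fun_eq_iff eval_bipoly_add)

lemma restricted_eval_0 [simp]: "restricted_eval 0 = 0"
  by (auto simp: restricted_eval_def fun_eq_iff)

lemma restricted_eval_sum: "restricted_eval (\<Sum>a\<in>A. f a) = (\<Sum>a\<in>A. restricted_eval (f a))"
  by (induction A rule: infinite_finite_induct) (auto simp: restricted_eval_add)

lemma restricted_eval_scale:
  "restricted_eval (Poly_Mapping.single 0 c * f) = ac_scale c (restricted_eval f)"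
  by (auto simp: restricted_eval_def ac_scale_def fun_eq_iff eval_bipoly_mult eval_bipoly_single
      monomial_at_def)

text \<open>
  Restriction to the graph identifies the component of bidegree \<open>(a, b)\<close> with the span of the Laurent
  functions with admissible exponents, of which the standard ones form a basis.
\<close>

lemma hilbert_function_eq:
  "quotient_dim (\<lambda>c f. Poly_Mapping.single 0 c * f) {f. bihomogeneous a b f}
       (vanishing_ideal (reciprocal_graph x))
     = card {g \<in> exponents (int a - int b) (int b). standard g}"
    (is "quotient_dim ?sc ?W ?U = card ?J")
proof (rule quotient_dim_eqI[where f = restricted_eval and e = laurent_fun])
  show "vector_space (ac_scale :: 'k \<Rightarrow> ('k alg_closure ^ 'i \<Rightarrow> _) \<Rightarrow> _)" by (rule vector_space_ac_scale)
  show "(\<Sum>b\<in>B. ?sc (c b) b) \<in> ?W" if "B \<subseteq> ?W" for B c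
    using that
    by (induction B rule: infinite_finite_induct)
      (auto intro: bihomogeneous_add bihomogeneous_scale simp: bihomogeneous_def[of _ _ 0])
  show "v - w \<in> ?W" if "v \<in> ?W" "w \<in> ?W" for v w using that by (simp add: bihomogeneous_diff)
  show "restricted_eval (v - w) = restricted_eval v - restricted_eval w" for v w
    by (auto simp: restricted_eval_def fun_eq_iff eval_bipoly_diff)
  show "restricted_eval (\<Sum>b\<in>B. ?sc (c b) b) = (\<Sum>b\<in>B. ac_scale (c b) (restricted_eval b))" for B c
    by (simp add: restricted_eval_sum restricted_eval_scale)
  show "w \<in> ?U \<longleftrightarrow> restricted_eval w = 0" if "w \<in> ?W" for w
    using that by (auto simp: in_vanishing_ideal_iff restricted_eval_def fun_eq_iff)
  show "finite ?J" by (rule finite_subset[OF _ finite_exponents]) auto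
  show "laurent_fun g \<in> restricted_eval ` ?W" if g: "g \<in> ?J" for g
  proof -
    have "g \<in> exponents (int a - int b) (int b)" using g by simp
    from exponent_diff_surj[OF this] obtain m
      where m: "bihomogeneous a b (Poly_Mapping.single m (1 :: 'k))" "exponent_diff m = g" .
    have "laurent_fun g = restricted_eval (Poly_Mapping.single m 1)"
      unfolding restricted_eval_single m(2) by (simp add: ac_scale_def)
    then show ?thesis using m(1) by blast
  qed
  show "c g = 0" if "(\<Sum>g\<in>?J. ac_scale (c g) (laurent_fun g)) = 0" "g \<in> ?J" for c g
    using standard_independent[OF \<open>finite ?J\<close> _ that] by simp
  show "restricted_eval ` ?W \<subseteq> module.span ac_scale (laurent_fun ` ?J)"
  proof
    fix h assume "h \<in> restricted_eval ` ?W"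
    then obtain f where f: "bihomogeneous a b f" "h = restricted_eval f" by blast
    have "h = (\<Sum>m\<in>Poly_Mapping.keys f.
        ac_scale (Poly_Mapping.lookup f m) (laurent_fun (exponent_diff m)))"
      unfolding f(2) by (subst bipoly_sum_singles) (simp add: restricted_eval_sum restricted_eval_single)
    also have "\<dots> \<in> module.span ac_scale (laurent_fun ` ?J)"
      using straightening exponent_diff_in_exponents[OF f(1)]
      by (intro ac.span_sum ac.span_scale) blast
    finally show "h \<in> module.span ac_scale (laurent_fun ` ?J)" .
  qed
qed

end

section \<open>Generating functions\<close>

text \<open>
  With \<open>D = {0<..}\<close> these are the pole orders for a given pole set; with \<open>D = UNIV\<close> they are the exponents
  of polynomials in the variables indexed by \<open>C\<close>.
\<close>

definition supported_functions :: "nat set \<Rightarrow> 'i set \<Rightarrow> nat \<Rightarrow> ('i \<Rightarrow> nat) set" where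
  "supported_functions D C n =
     {f. (\<forall>i\<in>C. f i \<in> D) \<and> (\<forall>i. i \<notin> C \<longrightarrow> f i = 0) \<and> (\<Sum>i\<in>C. f i) = n}"

lemma finite_supported_functions:
  assumes "finite C" shows "finite (supported_functions D C n)"
proof -
  have "f i \<le> n" if "f \<in> supported_functions D C n" "i \<in> C" for f i
    using that member_le_sum[of i C f] assms by (auto simp: supported_functions_def)
  then have "supported_functions D C n \<subseteq> {f. \<forall>i. (i \<in> C \<longrightarrow> f i \<in> {..n}) \<and> (i \<notin> C \<longrightarrow> f i = 0)}"
    by (auto simp: supported_functions_def)
  then show ?thesis
    by (rule finite_subset) (intro finite_set_of_finite_funs assms finite_atMost)
qed

definition indicator_series :: "nat set \<Rightarrow> 'a::comm_ring_1 fps" where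
  "indicator_series D = Abs_fps (\<lambda>n. if n \<in> D then 1 else 0)"

lemma card_supported_functions_insert:
  assumes "finite C" "c \<notin> C"
  shows "card (supported_functions D (insert c C) n)
       = (\<Sum>k\<in>{0..n} \<inter> D. card (supported_functions D C (n - k)))"
proof -
  let ?F = "\<lambda>k. (\<lambda>f. f(c := k)) ` supported_functions D C (n - k)"
  have sum_upd: "(\<Sum>i\<in>C. (f(c := k)) i) = (\<Sum>i\<in>C. f i)" for f :: "'a \<Rightarrow> nat" and k
    using assms(2) by (intro sum.cong) auto
  have "supported_functions D (insert c C) n = (\<Union>k\<in>{0..n} \<inter> D. ?F k)"
  proof (intro equalityI subsetI)
    fix f assume f: "f \<in> supported_functions D (insert c C) n"
    have "f c \<in> {0..n} \<inter> D" using f assms by (auto simp: supported_functions_def)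
    moreover have "f = (f(c := 0))(c := f c)" by simp
    moreover have "f(c := 0) \<in> supported_functions D C (n - f c)"
      using f assms sum_upd[of f 0] by (auto simp: supported_functions_def)
    ultimately show "f \<in> (\<Union>k\<in>{0..n} \<inter> D. ?F k)" by blast
  next
    fix f assume "f \<in> (\<Union>k\<in>{0..n} \<inter> D. ?F k)"
    then obtain k g where k: "k \<le> n" "k \<in> D" and g: "g \<in> supported_functions D C (n - k)" "f = g(c := k)"
      by auto
    then show "f \<in> supported_functions D (insert c C) n"
      using assms sum_upd[of g k] by (auto simp: supported_functions_def)
  qed
  also have "card \<dots> = (\<Sum>k\<in>{0..n} \<inter> D. card (?F k))"
  proof (rule card_UN_disjoint)
    show "\<forall>i\<in>{0..n} \<inter> D. finite (?F i)" using finite_supported_functions[OF assms(1)] by blast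
    show "\<forall>i\<in>{0..n} \<inter> D. \<forall>j\<in>{0..n} \<inter> D. i \<noteq> j \<longrightarrow> ?F i \<inter> ?F j = {}"
      by (auto dest: fun_cong[where x = c])
  qed simp
  also have "\<dots> = (\<Sum>k\<in>{0..n} \<inter> D. card (supported_functions D C (n - k)))"
  proof (rule sum.cong[OF refl], rule card_image, rule inj_onI)
    fix k f g
    assume "f \<in> supported_functions D C (n - k)" "g \<in> supported_functions D C (n - k)"
      and eq: "f(c := k) = g(c := k)"
    then have "f c = g c" using assms(2) by (simp add: supported_functions_def)
    then show "f = g" using eq by (metis fun_upd_triv fun_upd_upd)
  qed
  finally show ?thesis .
qed

lemma supported_functions_series:
  fixes C :: "'i set"
  assumes "finite C"
  shows "Abs_fps (\<lambda>n. of_nat (card (supported_functions D C n))) = indicator_series D ^ card C"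
  using assms
proof (induction C rule: finite_induct)
  case empty
  have "supported_functions D ({} :: 'i set) n = (if n = 0 then {\<lambda>_. 0} else {})" for n
    by (auto simp: supported_functions_def)
  then show ?case by (intro fps_ext) auto
next
  case (insert c C)
  have "of_nat (card (supported_functions D (insert c C) n))
      = fps_nth (indicator_series D * Abs_fps (\<lambda>n. of_nat (card (supported_functions D C n)))) n" for n
  proof -
    have "(of_nat (card (supported_functions D (insert c C) n)) :: 'b)
        = (\<Sum>k\<in>{0..n} \<inter> D. of_nat (card (supported_functions D C (n - k))))"
      by (simp add: card_supported_functions_insert[OF insert.hyps])
    also have "\<dots> = (\<Sum>k\<in>{0..n}. (if k \<in> D then 1 else 0) * of_nat (card (supported_functions D C (n - k))))"
      by (intro sum.mono_neutral_cong_left) auto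
    finally show ?thesis by (simp add: fps_mult_nth indicator_series_def)
  qed
  then show ?case using insert by (intro fps_ext) (simp add: insert.IH[symmetric])
qed

lemma indicator_series_UNIV: "indicator_series UNIV * (1 - fps_X) = 1"
proof (rule fps_ext)
  fix n :: nat
  show "fps_nth (indicator_series UNIV * (1 - fps_X)) n = fps_nth (1 :: 'a fps) n"
    by (cases n) (simp_all add: indicator_series_def right_diff_distrib)
qed

lemma indicator_series_positive: "indicator_series {0<..} * (1 - fps_X) = fps_X"
proof -
  have "indicator_series {0<..} = fps_X * (indicator_series UNIV :: 'a fps)"
    by (rule fps_ext) (auto simp: indicator_series_def)
  then show ?thesis by (simp add: mult.assoc indicator_series_UNIV)
qed

context form_arrangement
begin

text \<open>
  A coordinate sum \<open>a - b\<close> together with a negative part of degree \<open>b\<close> means that the positive part has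
  degree \<open>a\<close>.
\<close>

definition standard_of_bidegree :: "nat \<Rightarrow> nat \<Rightarrow> ('i \<Rightarrow> int) set" where
  "standard_of_bidegree a b =
     {g. standard g \<and> (\<Sum>i\<in>UNIV. g i) = int a - int b \<and> neg_degree g = int b}"

lemma finite_standard_exponents: "finite {g \<in> exponents s d. standard g}"
  by (rule finite_subset[OF _ finite_exponents]) auto

lemma neg_degree_nonneg: "0 \<le> neg_degree g"
  unfolding neg_degree_def by (auto intro: sum_nonneg)

lemma sum_plus_neg_degree: "(\<Sum>i\<in>UNIV. g i) + neg_degree g = (\<Sum>i\<in>UNIV. max 0 (g i))"
  unfolding neg_degree_def sum.distrib[symmetric] by (intro sum.cong) auto

text \<open>
  This recursion is multiplication of the Hilbert series by $1 - qt$: the exponents whose negative part has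
  degree less than \<open>b\<close> are those counted in bidegree \<open>(a - 1, b - 1)\<close>. When \<open>a\<close> or \<open>b\<close> is \<open>0\<close> there are
  none, as the positive or the negative part would have negative degree.
\<close>

lemma card_standard_rec:
  "card {g \<in> exponents (int a - int b) (int b). standard g} = card (standard_of_bidegree a b) +
     (if a = 0 \<or> b = 0 then 0
      else card {g \<in> exponents (int (a - 1) - int (b - 1)) (int (b - 1)). standard g})"
proof -
  let ?E = "\<lambda>d. {g \<in> exponents (int a - int b) d. standard g}"
  have "?E (int b) = standard_of_bidegree a b \<union> ?E (int b - 1)"
    by (auto simp: exponents_def standard_of_bidegree_def)
  moreover have "standard_of_bidegree a b \<inter> ?E (int b - 1) = {}"
    by (auto simp: exponents_def standard_of_bidegree_def)
  moreover have "finite (standard_of_bidegree a b)"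
    by (rule finite_subset[OF _ finite_standard_exponents[of "int a - int b" "int b"]])
      (auto simp: standard_of_bidegree_def exponents_def)
  ultimately have card: "card (?E (int b)) = card (standard_of_bidegree a b) + card (?E (int b - 1))"
    using finite_standard_exponents by (simp add: card_Un_disjoint)
  show ?thesis
  proof (cases "a = 0 \<or> b = 0")
    case True
    have "g \<notin> ?E (int b - 1)" for g
    proof
      assume g: "g \<in> ?E (int b - 1)"
      have "0 \<le> (\<Sum>i\<in>UNIV. max 0 (g i))" by (auto intro: sum_nonneg)
      then show False
        using g True neg_degree_nonneg[of g] sum_plus_neg_degree[of g] by (auto simp: exponents_def)
    qed
    then have empty: "?E (int b - 1) = {}" by blast
    show ?thesis unfolding card empty using True by simp
  next
    case False
    then have "int (a - 1) - int (b - 1) = int a - int b" "int (b - 1) = int b - 1" by auto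
    then show ?thesis using card False by simp
  qed
qed

text \<open>
  A standard exponent is the difference of its positive and negative parts. The negative part is
  supported exactly on a set \<open>B\<close> without broken circuits, and the positive part is supported in the
  complement chosen for \<open>B\<close>.
\<close>

lemma card_standard_of_bidegree:
  "card (standard_of_bidegree a b) = (\<Sum>B\<in>{B. forms.nbc B}.
     card (supported_functions {0<..} B b) * card (supported_functions UNIV (forms.compl_basis B) a))"
proof -
  let ?S = "\<lambda>B. {g \<in> standard_of_bidegree a b. {i. g i < 0} = B}"
  let ?P = "\<lambda>B. supported_functions {0<..} B b \<times> supported_functions UNIV (forms.compl_basis B) a"
  have fin: "finite (standard_of_bidegree a b)"
    by (rule finite_subset[OF _ finite_standard_exponents[of "int a - int b" "int b"]])
      (auto simp: standard_of_bidegree_def exponents_def)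
  have "card (?S B) = card (?P B)" if B: "forms.nbc B" for B
  proof (rule bij_betw_same_card[OF bij_betw_byWitness])
    let ?split = "\<lambda>g :: 'i \<Rightarrow> int. (\<lambda>i. nat (- g i), \<lambda>i. nat (g i))"
    let ?join = "\<lambda>(p, q) i :: 'i. int (q i) - int (p i)"
    have disj: "i \<notin> forms.compl_basis B" if "i \<in> B" for i
      using forms.compl_basis_disjoint[of B] that by blast
    have sums: "(\<Sum>i\<in>C. h i) = (\<Sum>i\<in>UNIV. h i)" if "\<And>i. i \<notin> C \<Longrightarrow> h i = 0" for C and h :: "'i \<Rightarrow> nat"
      using that by (intro sum.mono_neutral_left) auto
    show "\<forall>g\<in>?S B. ?join (?split g) = g" by auto
    have at: "(q i = 0 \<or> p i = 0) \<and> (0 < p i \<longleftrightarrow> i \<in> B) \<and> (0 < q i \<longrightarrow> i \<in> forms.compl_basis B)"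
      if "(p, q) \<in> ?P B" for p q i
      using that disj[of i] by (force simp: supported_functions_def)
    show "\<forall>pq\<in>?P B. ?split (?join pq) = pq"
    proof
      fix pq assume "pq \<in> ?P B"
      then obtain p q where pq: "pq = (p, q)" "(p, q) \<in> ?P B" by (cases pq) auto
      have "nat (- (int (q i) - int (p i))) = p i \<and> nat (int (q i) - int (p i)) = q i" for i
        using at[OF pq(2), of i] by auto
      then show "?split (?join pq) = pq" using pq by simp
    qed
    show "?split ` ?S B \<subseteq> ?P B"
    proof
      fix pq assume "pq \<in> ?split ` ?S B"
      then obtain g where g: "g \<in> ?S B" "pq = ?split g" by blast
      have neg: "int (\<Sum>i\<in>UNIV. nat (- g i)) = neg_degree g"
        unfolding neg_degree_def of_nat_sum by (intro sum.cong) auto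
      have pos: "int (\<Sum>i\<in>UNIV. nat (g i)) = (\<Sum>i\<in>UNIV. g i) + neg_degree g"
        unfolding sum_plus_neg_degree of_nat_sum by (intro sum.cong) auto
      have compl: "i \<in> forms.compl_basis B" if "0 < g i" for i
        using g(1) that by (auto simp: standard_of_bidegree_def standard_def)
      have deg: "neg_degree g = int b" "(\<Sum>i\<in>UNIV. g i) = int a - int b"
        using g(1) by (auto simp: standard_of_bidegree_def)
      have "(\<Sum>i\<in>B. nat (- g i)) = (\<Sum>i\<in>UNIV. nat (- g i))"
        by (rule sums) (use g(1) in auto)
      also have "\<dots> = b" using neg unfolding deg of_nat_eq_iff .
      finally have "(\<Sum>i\<in>B. nat (- g i)) = b" .
      moreover have "(\<Sum>i\<in>forms.compl_basis B. nat (g i)) = (\<Sum>i\<in>UNIV. nat (g i))"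
        by (rule sums) (use compl in force)
      then have "(\<Sum>i\<in>forms.compl_basis B. nat (g i)) = a"
        using pos unfolding deg diff_add_cancel of_nat_eq_iff by simp
      ultimately show "pq \<in> ?P B"
        using g compl by (force simp: supported_functions_def)
    qed
    show "?join ` ?P B \<subseteq> ?S B"
    proof
      fix g assume "g \<in> ?join ` ?P B"
      then obtain p q where pq: "(p, q) \<in> ?P B" and g: "g = (\<lambda>i. int (q i) - int (p i))" by auto
      note at = at[OF pq]
      have p: "(\<Sum>i\<in>UNIV. p i) = b" and q: "(\<Sum>i\<in>UNIV. q i) = a"
        using pq sums[of B p] sums[of "forms.compl_basis B" q] by (auto simp: supported_functions_def)
      have B_eq: "{i. g i < 0} = B" using at by (force simp: g)
      have "neg_degree g = int (\<Sum>i\<in>UNIV. p i)"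
        unfolding neg_degree_def of_nat_sum g
      proof (rule sum.cong[OF refl])
        show "max 0 (- (int (q i) - int (p i))) = int (p i)" for i using at[of i] by auto
      qed
      moreover have "(\<Sum>i\<in>UNIV. g i) = int (\<Sum>i\<in>UNIV. q i) - int (\<Sum>i\<in>UNIV. p i)"
        by (simp add: g sum_subtractf)
      moreover have "standard g" unfolding standard_def B_eq using B at by (force simp: g)
      ultimately show "g \<in> ?S B" using p q B_eq by (simp add: standard_of_bidegree_def)
    qed
  qed
  then have "(\<Sum>B\<in>{B. forms.nbc B}. card (?S B)) = (\<Sum>B\<in>{B. forms.nbc B}. card (?P B))" by simp
  moreover have "(\<Sum>B\<in>{B. forms.nbc B}. card (?S B)) = card (standard_of_bidegree a b)"
    using sum.group[OF fin, of "{B. forms.nbc B}" "\<lambda>g. {i. g i < 0}" "\<lambda>_. 1 :: nat"]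
    by (auto simp: standard_of_bidegree_def standard_def)
  ultimately show ?thesis by (simp add: card_cartesian_product)
qed

lemma hilbert_series_eq:
  "hilbert_series (vanishing_ideal (reciprocal_graph x)) * (1 - fps_X * fps_const fps_X) =
     (\<Sum>B\<in>{B. forms.nbc B}. fps_const (indicator_series {0<..}) ^ card B
                              * indicator_series UNIV ^ card (forms.compl_basis B))"
    (is "?H * _ = ?R")
proof -
  define h where "h a b = card {g \<in> exponents (int a - int b) (int b). standard g}" for a b
  have H: "fps_nth (fps_nth ?H a) b = int (h a b)" for a b
    by (simp add: hilbert_series_def hilbert_function_eq h_def)
  have shift: "fps_nth (fps_nth (fps_X * (fps_const fps_X * ?H)) a) b
      = (if a = 0 \<or> b = 0 then 0 else int (h (a - 1) (b - 1)))" for a b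
    by (auto simp: H)
  have R: "fps_nth (fps_nth ?R a) b = int (card (standard_of_bidegree a b))" for a b
  proof -
    have "fps_nth (fps_nth (fps_const (indicator_series {0<..}) ^ card B
             * indicator_series UNIV ^ card (forms.compl_basis B)) a) b
        = int (card (supported_functions {0<..} B b))
          * int (card (supported_functions UNIV (forms.compl_basis B) a))" for B
    proof -
      let ?p = "indicator_series {0<..} ^ card B :: int fps"
      let ?q = "indicator_series UNIV ^ card (forms.compl_basis B) :: int fps fps"
      let ?n = "card (supported_functions UNIV (forms.compl_basis B) a)"
      have p: "fps_nth ?p b = int (card (supported_functions {0<..} B b))"
        by (subst supported_functions_series[symmetric]) simp_all
      have "fps_nth ?q a = of_nat ?n"
        by (subst supported_functions_series[symmetric]) (simp_all only: finite fps_nth_Abs_fps)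
      then have q: "fps_nth ?q a = fps_const (int ?n)" by (simp add: fps_of_nat)
      have "fps_nth (fps_nth (fps_const (indicator_series {0<..}) ^ card B * ?q) a) b
          = fps_nth (?p * fps_nth ?q a) b" by simp
      also have "\<dots> = fps_nth ?p b * int ?n" unfolding q by simp
      finally show ?thesis unfolding p .
    qed
    then show ?thesis by (simp add: fps_sum_nth card_standard_of_bidegree)
  qed
  have "?H = ?R + fps_X * (fps_const fps_X * ?H)"
  proof (intro fps_ext)
    fix a b
    show "fps_nth (fps_nth ?H a) b = fps_nth (fps_nth (?R + fps_X * (fps_const fps_X * ?H)) a) b"
      unfolding fps_add_nth R shift H unfolding h_def by (subst card_standard_rec) simp
  qed
  then show ?thesis by (simp add: algebra_simps)
qed

end

section \<open>The rational function\<close>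

lemma of_series_add: "of_series (f + g) = of_series f + of_series g"
  by (simp add: of_series_def)

lemma of_series_mult: "of_series (f * g) = of_series f * of_series g"
  by (simp add: of_series_def)

lemma of_series_diff: "of_series (f - g) = of_series f - of_series g"
  by (simp add: of_series_def)

lemma of_series_0 [simp]: "of_series 0 = 0" and of_series_1 [simp]: "of_series 1 = 1"
  by (simp_all add: of_series_def Zero_fract_def One_fract_def)

lemma of_series_power: "of_series (f ^ n) = of_series f ^ n"
  by (induction n) (simp_all add: of_series_mult)

lemma of_series_sum: "of_series (\<Sum>a\<in>A. f a) = (\<Sum>a\<in>A. of_series (f a))"
  by (induction A rule: infinite_finite_induct) (simp_all add: of_series_add)

lemma of_series_eq_iff: "of_series f = of_series g \<longleftrightarrow> f = g"
  by (simp add: of_series_def eq_fract)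

lemma poly_map_of_int_sum_monom:
  "poly (map_poly of_int (\<Sum>a\<in>A. Polynomial.monom (c a) (n a))) (y :: 'a::comm_ring_1)
     = (\<Sum>a\<in>A. of_int (c a) * y ^ n a)"
proof -
  have add: "map_poly (of_int :: int \<Rightarrow> 'a) (p + q) = map_poly of_int p + map_poly of_int q" for p q
    by (rule poly_eqI) (simp add: coeff_map_poly)
  show ?thesis
    by (induction A rule: infinite_finite_induct) (simp_all add: add map_poly_monom poly_monom)
qed

context form_arrangement
begin

text \<open>
  Each set \<open>B\<close> without broken circuits contributes the same term to both sides, because \<open>B\<close> and its
  complementary indices together number \<open>d\<close>.
\<close>

lemma hilbert_series_rational:
  assumes nonzero: "\<And>e. x e \<noteq> 0" and rank: "forms.rk UNIV = d"
  shows "of_series (hilbert_series (vanishing_ideal (reciprocal_graph x))) =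
           1 / (1 - var_q * var_t) * (var_t / (var_t - 1)) ^ d *
           poly (map_poly of_int (char_poly_matroid (matroid_of_forms x)))
                ((var_t - 1) / ((1 - var_q) * var_t))"
proof -
  let ?H = "of_series (hilbert_series (vanishing_ideal (reciprocal_graph x)))"
  let ?y = "(var_t - 1) / ((1 - var_q) * var_t)"
  have t0: "var_t \<noteq> 0" unfolding var_t_def of_series_0[symmetric] of_series_eq_iff by simp
  have "fps_nth (fps_const fps_X :: int fps fps) 0 \<noteq> fps_nth 1 0" by simp
  then have t1: "var_t \<noteq> 1" unfolding var_t_def of_series_1[symmetric] of_series_eq_iff by metis
  have q1: "var_q \<noteq> 1" unfolding var_q_def of_series_1[symmetric] of_series_eq_iff by simp
  have "fps_nth (fps_nth (fps_X * fps_const fps_X :: int fps fps) 0) 0 \<noteq> fps_nth (fps_nth 1 0) 0"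
    by simp
  then have "fps_X * fps_const fps_X \<noteq> (1 :: int fps fps)" by metis
  then have qt: "1 - var_q * var_t \<noteq> 0"
    unfolding var_q_def var_t_def of_series_mult[symmetric] using of_series_eq_iff[of _ 1] by simp
  have "of_series (indicator_series UNIV) * (1 - var_q) = 1"
    unfolding var_q_def
    by (metis indicator_series_UNIV of_series_1 of_series_diff of_series_mult)
  then have qs: "of_series (indicator_series UNIV) = 1 / (1 - var_q)" using q1 by (simp add: field_simps)
  have "fps_const (indicator_series {0<..}) * (1 - fps_const fps_X) = (fps_const fps_X :: int fps fps)"
    by (metis fps_const_1_eq_1 fps_const_mult fps_const_sub indicator_series_positive)
  then have "of_series (fps_const (indicator_series {0<..})) * (1 - var_t) = var_t"
    unfolding var_t_def by (metis of_series_1 of_series_diff of_series_mult)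
  then have ts: "of_series (fps_const (indicator_series {0<..})) = var_t / (1 - var_t)"
    using t1 by (simp add: field_simps)
  have summand: "(var_t / (1 - var_t)) ^ card B * (1 / (1 - var_q)) ^ card (forms.compl_basis B)
      = (var_t / (var_t - 1)) ^ d * ((-1) ^ card B * ?y ^ (d - card B))" if "forms.nbc B" for B
  proof -
    have d: "d = card B + card (forms.compl_basis B)" using forms.card_compl_basis[OF that] rank by simp
    have *: "- (var_t / (var_t - 1)) = var_t / (1 - var_t)" using t1 by (simp add: field_simps)
    have **: "var_t / (var_t - 1) * ?y = 1 / (1 - var_q)" using t0 t1 by simp
    have "(var_t / (var_t - 1)) ^ d * ((-1) ^ card B * ?y ^ (d - card B))
        = (- (var_t / (var_t - 1))) ^ card B * (var_t / (var_t - 1) * ?y) ^ card (forms.compl_basis B)"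
      unfolding d by (simp only: power_add power_mult_distrib power_minus[of "var_t / (var_t - 1)"]
          add_diff_cancel_left' mult_ac)
    then show ?thesis unfolding * ** by simp
  qed
  have "?H * (1 - var_q * var_t) = of_series (\<Sum>B\<in>{B. forms.nbc B}.
      fps_const (indicator_series {0<..}) ^ card B * indicator_series UNIV ^ card (forms.compl_basis B))"
    unfolding var_q_def var_t_def hilbert_series_eq[symmetric]
    by (simp add: of_series_mult of_series_diff)
  also have "\<dots> = (\<Sum>B\<in>{B. forms.nbc B}.
      (var_t / (1 - var_t)) ^ card B * (1 / (1 - var_q)) ^ card (forms.compl_basis B))"
    by (simp only: of_series_sum of_series_mult of_series_power qs ts)
  also have "\<dots> = (\<Sum>B\<in>{B. forms.nbc B}. (var_t / (var_t - 1)) ^ d * ((-1) ^ card B * ?y ^ (d - card B)))"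
    by (intro sum.cong refl summand) simp
  also have "\<dots> = (var_t / (var_t - 1)) ^ d *
      poly (map_poly of_int (char_poly_matroid (matroid_of_forms x))) ?y"
    unfolding matroid_of_forms_eq forms.char_poly_eq_sum_nbc[OF nonzero] rank
      poly_map_of_int_sum_monom sum_distrib_left by simp
  finally have "?H = (var_t / (var_t - 1)) ^ d *
      poly (map_poly of_int (char_poly_matroid (matroid_of_forms x))) ?y / (1 - var_q * var_t)"
    by (rule nonzero_eq_divide_eq[OF qt, THEN iffD2])
  then show ?thesis by simp
qed

end

theorem proposition2:
  fixes sc :: "'k::field \<Rightarrow> 'v::ab_group_add \<Rightarrow> 'v"
    and H :: "'i::finite \<Rightarrow> 'v set"
    and x :: "'i \<Rightarrow> 'v \<Rightarrow> 'k"
    and n r :: nat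
  assumes "vector_space sc"
    and "vector_space.dim sc UNIV = r + 1"
    and "CARD('i) = n + 1"
    and "\<And>i. module.subspace sc (H i)"
    and "\<And>i. vector_space.dim sc (H i) = r"
    and "inj H"
    and "(\<Inter>i. H i) = {0}"
    and "\<And>i. Vector_Spaces.linear sc (*) (x i)"
    and "\<And>i. {v. x i v = 0} = H i"
  shows "of_series (hilbert_series (vanishing_ideal (reciprocal_graph x))) =
           1 / (1 - var_q * var_t) * (var_t / (var_t - 1)) ^ (r + 1) *
           poly (map_poly of_int (char_poly_matroid (matroid_of_forms x)))
                ((var_t - 1) / ((1 - var_q) * var_t))"
proof -
  obtain ord :: "'i \<Rightarrow> nat" where "inj ord"
    using finite_imp_inj_to_nat_seg[of "UNIV :: 'i set"] by auto
  interpret form_arrangement sc x ord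
    by (intro form_arrangement.intro form_arrangement_axioms.intro assms(1,8) \<open>inj ord\<close>)
  show ?thesis
  proof (rule hilbert_series_rational)
    show "x e \<noteq> 0" for e
    proof
      assume "x e = 0"
      then have "H e = UNIV" using assms(9)[of e] by auto
      then show False using assms(2) assms(5)[of e] by simp
    qed
    have "v = 0" if "\<And>i. x i v = 0" for v using that assms(7,9) by blast
    then show "forms.rk UNIV = r + 1" using rank_eq_dim assms(2) by simp
  qed
qed

end
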